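(* Let $d\ge 1$ be an integer and let $g_1,\dots,g_m:\mathbb{R}^n\to\mathbb{R}$ be polynomial functions whose degree is bounded by $d$. Let $\{I,J\}$ be a partition of the set of indices $\{1,\dots,m\}$, possibly trivial (i.e. $I$ or $J$ may be empty), such that the Mangasarian-Fromovitz constraint qualification holds at every point of $\{x\in\mathbb{R}^n \mid g_j(x)\le 0,\ j\in J\}$. Then, for the perturbed sets $$\{x\in\mathbb{R}^n \mid g_i(x)\le\alpha,\ i\in I,\ \ g_j(x)\le 0,\ j\in J\}$$ with $\alpha$ ranging in $\mathbb{R}$, the number of singular perturbations $\alpha$ is bounded by $$d\,(2d-1)^n\,(2d+1)^m.$$
   Context: For a set of the form $\{x \mid g_i(x)\le\mu_i,\ i\in S\}$ with $S$ a finite index set and $\mu_i\in\mathbb{R}$, a point $x$ of the set satisfies the Mangasarian-Fromovitz constraint qualification (MFCQ) if there exists $y\in\mathbb{R}^n$ with $\langle y,\nabla g_i(x)\rangle<0$ for every $i\in S$ with $g_i(x)=\mu_i$ (vacuous if there is no such $i$). A value $\alpha\in\mathbb{R}$ is called a singular perturbation if MFCQ fails at some point of the perturbed set $\{x \mid g_i(x)\le\alpha,\ i\in I,\ g_j(x)\le 0,\ j\in J\}$. *)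

theory Defs
  imports "HOL-Analysis.Analysis"
begin

text \<open>
  A multi-index is a vector \<open>e :: nat ^ 'n\<close>, standing for the monomial whose exponent in the
  coordinate \<open>x $ i\<close> is \<open>e $ i\<close>; the degree is the total degree.
\<close>

definition poly_function_deg_le :: "nat \<Rightarrow> (real ^ 'n \<Rightarrow> real) \<Rightarrow> bool" where
  "poly_function_deg_le d f \<longleftrightarrow>
     (\<exists>c :: nat ^ 'n \<Rightarrow> real. \<forall>x.
        f x = (\<Sum>e | (\<Sum>i\<in>UNIV. e $ i) \<le> d. c e * (\<Prod>i\<in>UNIV. (x $ i) ^ (e $ i))))"

text \<open>The index set of the sum above is finite, so the sum is not the default value 0.\<close>

lemma finite_multi_indices: "finite {e :: nat ^ 'n. (\<Sum>i\<in>UNIV. e $ i) \<le> d}"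
proof (rule finite_subset)
  show "{e :: nat ^ 'n. (\<Sum>i\<in>UNIV. e $ i) \<le> d} \<subseteq> vec_lambda ` {f. \<forall>i. f i \<in> {..d}}"
  proof
    fix e :: "nat ^ 'n"
    assume "e \<in> {e. (\<Sum>i\<in>UNIV. e $ i) \<le> d}"
    hence "e $ i \<le> d" for i
      using member_le_sum[of i UNIV "\<lambda>i. e $ i"] by simp
    moreover have "e = vec_lambda (\<lambda>i. e $ i)" by simp
    ultimately show "e \<in> vec_lambda ` {f. \<forall>i. f i \<in> {..d}}" by blast
  qed
  have "{f :: 'n \<Rightarrow> nat. \<forall>i. f i \<in> {..d}} = Pi\<^sub>E UNIV (\<lambda>_. {..d})"
    by (auto simp: PiE_def Pi_def)
  then show "finite (vec_lambda ` {f :: 'n \<Rightarrow> nat. \<forall>i. f i \<in> {..d}})"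
    by (simp add: finite_PiE)
qed

lemma poly_function_deg_le_imp_real_polynomial_function:
  fixes f :: "real ^ 'n \<Rightarrow> real"
  assumes "poly_function_deg_le d f"
  shows "real_polynomial_function f"
proof -
  from assms obtain c :: "nat ^ 'n \<Rightarrow> real" where
    "\<And>x. f x = (\<Sum>e | (\<Sum>i\<in>UNIV. e $ i) \<le> d. c e * (\<Prod>i\<in>UNIV. (x $ i) ^ (e $ i)))"
    unfolding poly_function_deg_le_def by blast
  hence "f = (\<lambda>x. \<Sum>e | (\<Sum>i\<in>UNIV. e $ i) \<le> d. c e * (\<Prod>i\<in>UNIV. (x $ i) ^ (e $ i)))"
    by blast
  moreover have "real_polynomial_function \<dots>"
    by (intro real_polynomial_function_sum real_polynomial_function_prod
          real_polynomial_function_power real_polynomial_function.intros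
          finite_multi_indices finite_class.finite_UNIV bounded_linear_vec_nth)
  ultimately show ?thesis by simp
qed

definition gradient :: "(real ^ 'n \<Rightarrow> real) \<Rightarrow> real ^ 'n \<Rightarrow> real ^ 'n" where
  "gradient f x = (THE D. GDERIV f x :> D)"

lemma gradient_eqI:
  assumes "GDERIV f x :> D"
  shows "gradient f x = D"
  unfolding gradient_def
proof (rule the_equality)
  show "GDERIV f x :> D" by (rule assms)
next
  fix D' assume "GDERIV f x :> D'"
  with assms have "(\<lambda>h. h \<bullet> D') = (\<lambda>h. h \<bullet> D)"
    unfolding gderiv_def by (intro has_derivative_unique)
  thus "D' = D"
    using vector_eq_ldot[of D' D] by (simp add: fun_eq_iff)
qed

lemma GDERIV_gradient:
  fixes f :: "real ^ 'n \<Rightarrow> real"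
  assumes "f differentiable (at x)"
  shows "GDERIV f x :> gradient f x"
proof -
  from assms obtain f' where f': "(f has_derivative f') (at x)"
    unfolding differentiable_def by blast
  then interpret linear f' by (rule has_derivative_linear)
  define D :: "real ^ 'n" where "D = (\<Sum>b\<in>Basis. f' b *\<^sub>R b)"
  have "f' h = h \<bullet> D" for h
  proof -
    have "f' h = f' (\<Sum>b\<in>Basis. (h \<bullet> b) *\<^sub>R b)"
      by (simp add: euclidean_representation)
    also have "\<dots> = h \<bullet> D"
      by (simp add: sum scale D_def inner_sum_right mult.commute)
    finally show ?thesis .
  qed
  hence "f' = (\<lambda>h. h \<bullet> D)" by blast
  with f' have "GDERIV f x :> D" by (simp add: gderiv_def)
  thus ?thesis by (simp add: gradient_eqI)
qed

definition feasible_set ::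
    "(nat \<Rightarrow> real ^ 'n \<Rightarrow> real) \<Rightarrow> (nat \<Rightarrow> real) \<Rightarrow> nat set \<Rightarrow> (real ^ 'n) set" where
  "feasible_set g \<mu> S = {x. \<forall>i\<in>S. g i x \<le> \<mu> i}"

definition MFCQ ::
    "(nat \<Rightarrow> real ^ 'n \<Rightarrow> real) \<Rightarrow> (nat \<Rightarrow> real) \<Rightarrow> nat set \<Rightarrow> real ^ 'n \<Rightarrow> bool" where
  "MFCQ g \<mu> S x \<longleftrightarrow> (\<exists>y. \<forall>i\<in>S. g i x = \<mu> i \<longrightarrow> y \<bullet> gradient (g i) x < 0)"

definition perturbation_level :: "nat set \<Rightarrow> real \<Rightarrow> nat \<Rightarrow> real" where
  "perturbation_level I \<alpha> i = (if i \<in> I then \<alpha> else 0)"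

definition singular_perturbation ::
    "(nat \<Rightarrow> real ^ 'n \<Rightarrow> real) \<Rightarrow> nat set \<Rightarrow> nat set \<Rightarrow> real \<Rightarrow> bool" where
  "singular_perturbation g I J \<alpha> \<longleftrightarrow>
     (\<exists>x \<in> feasible_set g (perturbation_level I \<alpha>) (I \<union> J).
        \<not> MFCQ g (perturbation_level I \<alpha>) (I \<union> J) x)"

text \<open>For disjoint \<open>I\<close> and \<open>J\<close> the perturbed set is the expected one.\<close>

lemma feasible_set_perturbation_level:
  assumes "I \<inter> J = {}"
  shows "feasible_set g (perturbation_level I \<alpha>) (I \<union> J) =
           {x. (\<forall>i\<in>I. g i x \<le> \<alpha>) \<and> (\<forall>j\<in>J. g j x \<le> 0)}"
  using assms by (auto simp: feasible_set_def perturbation_level_def split: if_splits)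

end

theory Submission
  imports Defs "HOL-Computational_Algebra.Polynomial" "HOL-Real_Asymp.Real_Asymp"
begin

text \<open>
  At a singular perturbation \<open>\<alpha>\<close> the gradients of the active constraints have a nontrivial nonnegative
  combination that vanishes (\<open>gordan\<close>). The qualification assumed for \<open>J\<close> ensures that some index in \<open>I\<close>
  takes part in it, so the multipliers can be normalized to have sum \<open>1\<close> over the active indices in
  \<open>I\<close>. Then \<open>\<alpha>\<close> is a critical value of a Lagrange function, a polynomial of degree \<open>d + 1\<close> in the point
  and the multipliers, which depends only on the set \<open>K\<close> of active indices. Summed over all \<open>K\<close>, the
  bound \<open>(2 d - 1) ^ (n + card K)\<close> for each of these polynomials gives
  \<open>(2 d - 1) ^ n * (2 d) ^ m\<close>, which is at most the required number.

  It remains to see that a polynomial of degree \<open>d + 1\<close> in \<open>N\<close> variables has at most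
  \<open>(2 d - 1) ^ N\<close> critical values (\<open>critical_values_bound\<close>). The squared length \<open>P\<close> of its gradient
  has degree \<open>2 d\<close> and is zero exactly at the critical points. For each of finitely many chosen critical
  values, a small perturbation of \<open>P\<close> has a local minimum at which the value of the polynomial is close
  to the chosen one. These minima solve a system of \<open>N\<close> equations of degree \<open>2 d - 1\<close>. Two facts are
  needed.

  The critical values must be separated from each other by noncritical levels. This follows from
  countability: every critical value is algebraic over the ring generated by the coefficients, because
  a derivation that is trivial on that ring kills all critical values, but can be chosen nonzero at any
  number that is transcendental over the ring (\<open>countable_critical_values\<close>).

  A generic system of \<open>N\<close> equations of degree \<open>D\<close> must have at most \<open>D ^ N\<close> solutions, counted by the
  values of a given polynomial \<open>h\<close> on them. This follows from a relation of degree at most \<open>D ^ N\<close> in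
  \<open>h\<close> between \<open>h\<close> and the left-hand sides, which exists by a comparison of dimensions
  (\<open>polynomial_relation\<close>).
\<close>

section \<open>Derivations of subrings of the reals\<close>

definition subring_of_reals :: "real set \<Rightarrow> bool" where
  "subring_of_reals M \<longleftrightarrow> 1 \<in> M \<and> (\<forall>a\<in>M. \<forall>b\<in>M. a - b \<in> M \<and> a * b \<in> M)"

definition derivation_on :: "real set \<Rightarrow> (real \<Rightarrow> real) \<Rightarrow> bool" where
  "derivation_on M D \<longleftrightarrow>
     (\<forall>a\<in>M. \<forall>b\<in>M. D (a + b) = D a + D b \<and> D (a * b) = a * D b + D a * b)"

definition coeffs_in :: "real set \<Rightarrow> real poly \<Rightarrow> bool" where
  "coeffs_in M p \<longleftrightarrow> (\<forall>i. coeff p i \<in> M)"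

lemma subring_closed:
  assumes "subring_of_reals M"
  shows "0 \<in> M" "1 \<in> M" "a \<in> M \<Longrightarrow> b \<in> M \<Longrightarrow> a + b \<in> M"
    "a \<in> M \<Longrightarrow> b \<in> M \<Longrightarrow> a - b \<in> M" "a \<in> M \<Longrightarrow> b \<in> M \<Longrightarrow> a * b \<in> M"
proof -
  show one: "1 \<in> M" using assms by (simp add: subring_of_reals_def)
  show minus: "a - b \<in> M" if "a \<in> M" "b \<in> M" for a b
    using that assms by (simp add: subring_of_reals_def)
  show "a \<in> M \<Longrightarrow> b \<in> M \<Longrightarrow> a * b \<in> M" using assms by (simp add: subring_of_reals_def)
  show zero: "0 \<in> M" using minus[OF one one] by simp
  show "a \<in> M \<Longrightarrow> b \<in> M \<Longrightarrow> a + b \<in> M" using minus[OF _ minus[OF zero], of a b] by simp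
qed

lemma subring_sum:
  assumes "subring_of_reals M" "\<And>i. i \<in> A \<Longrightarrow> f i \<in> M"
  shows "sum f A \<in> M"
  using assms(2) by (induction A rule: infinite_finite_induct) (auto intro: subring_closed[OF assms(1)])

lemma coeffs_in_closed:
  assumes "subring_of_reals M"
  shows "coeffs_in M p \<Longrightarrow> coeffs_in M q \<Longrightarrow> coeffs_in M (p + q)"
    and "coeffs_in M p \<Longrightarrow> coeffs_in M q \<Longrightarrow> coeffs_in M (p - q)"
    and "coeffs_in M p \<Longrightarrow> coeffs_in M q \<Longrightarrow> coeffs_in M (p * q)"
    and "c \<in> M \<Longrightarrow> coeffs_in M (monom c n)"
    and "c \<in> M \<Longrightarrow> coeffs_in M [:c:]"
    and "coeffs_in M [:0, 1:]"
  by (auto simp: coeffs_in_def coeff_mult coeff_pCons split: nat.splits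
      intro!: subring_closed[OF assms] subring_sum[OF assms])

lemma derivation_basic:
  assumes "derivation_on M D" "subring_of_reals M"
  shows "D 0 = 0" "D 1 = 0" "a \<in> M \<Longrightarrow> b \<in> M \<Longrightarrow> D (a - b) = D a - D b"
proof -
  note cl = subring_closed[OF assms(2)]
  show 0: "D 0 = 0"
    using assms(1) cl(1) unfolding derivation_on_def by (metis add.right_neutral add_left_cancel)
  have "D (1 * 1) = 1 * D 1 + D 1 * 1"
    using assms(1) cl(2) unfolding derivation_on_def by blast
  then show "D 1 = 0" by simp
  assume "a \<in> M" "b \<in> M"
  then have "D ((a - b) + b) = D (a - b) + D b"
    using assms(1) cl unfolding derivation_on_def by blast
  then show "D (a - b) = D a - D b" by simp
qed

lemma derivation_sum:
  assumes "derivation_on M D" "subring_of_reals M" "\<And>i. i \<in> A \<Longrightarrow> f i \<in> M"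
  shows "D (sum f A) = (\<Sum>i\<in>A. D (f i))"
  using assms(3)
proof (induction A rule: infinite_finite_induct)
  case (insert x F)
  then show ?case
    using assms(1) subring_sum[OF assms(2), of F f] by (simp add: derivation_on_def)
qed (auto simp: derivation_basic[OF assms(1,2)])

text \<open>The value that a derivation \<open>D\<close> of \<open>M[x]\<close> with \<open>D x = v\<close> must have at \<open>poly p x\<close>.\<close>

definition derivation_of_value :: "(real \<Rightarrow> real) \<Rightarrow> real \<Rightarrow> real \<Rightarrow> real poly \<Rightarrow> real" where
  "derivation_of_value D x v p = poly (map_poly D p) x + poly (pderiv p) x * v"

lemma derivation_of_value_add_diff:
  assumes "derivation_on M D" "subring_of_reals M" "coeffs_in M p" "coeffs_in M q"
  shows "derivation_of_value D x v (p + q) = derivation_of_value D x v p + derivation_of_value D x v q"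
    and "derivation_of_value D x v (p - q) = derivation_of_value D x v p - derivation_of_value D x v q"
proof -
  note D0 = derivation_basic[OF assms(1,2)]
  have "map_poly D (p + q) = map_poly D p + map_poly D q"
    using assms by (intro poly_eqI) (auto simp: coeff_map_poly D0 coeffs_in_def derivation_on_def)
  moreover have "map_poly D (p - q) = map_poly D p - map_poly D q"
    using assms by (intro poly_eqI) (auto simp: coeff_map_poly D0 coeffs_in_def)
  ultimately show "derivation_of_value D x v (p + q) = derivation_of_value D x v p + derivation_of_value D x v q"
    "derivation_of_value D x v (p - q) = derivation_of_value D x v p - derivation_of_value D x v q"
    unfolding derivation_of_value_def pderiv_add pderiv_diff
    by (simp_all only: poly_add poly_diff) (simp_all add: algebra_simps)
qed

text \<open>The Leibniz rule, which makes the candidate values on \<open>M[x]\<close> into a derivation.\<close>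

lemma derivation_of_value_mult:
  assumes "derivation_on M D" "subring_of_reals M" "coeffs_in M p" "coeffs_in M q"
  shows "derivation_of_value D x v (p * q) =
    poly p x * derivation_of_value D x v q + derivation_of_value D x v p * poly q x"
proof -
  note D0 = derivation_basic[OF assms(1,2)]
  have "map_poly D (p * q) = p * map_poly D q + map_poly D p * q"
  proof (rule poly_eqI)
    fix n
    have "D (\<Sum>i\<le>n. coeff p i * coeff q (n - i)) = (\<Sum>i\<le>n. D (coeff p i * coeff q (n - i)))"
      using assms(3,4) by (intro derivation_sum[OF assms(1,2)])
        (auto simp: coeffs_in_def intro: subring_closed[OF assms(2)])
    also have "\<dots> = (\<Sum>i\<le>n. coeff p i * D (coeff q (n - i)) + D (coeff p i) * coeff q (n - i))"
      using assms(1,3,4) by (intro sum.cong) (auto simp: coeffs_in_def derivation_on_def)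
    finally show "coeff (map_poly D (p * q)) n = coeff (p * map_poly D q + map_poly D p * q) n"
      by (simp add: coeff_map_poly D0 coeff_mult sum.distrib)
  qed
  then show ?thesis
    by (simp add: derivation_of_value_def pderiv_mult algebra_simps)
qed

text \<open>
  The vanishing condition says exactly that the prescribed value at \<open>poly p x\<close> depends only on that
  number and not on \<open>p\<close>, so that \<open>D\<close> extends to the ring \<open>M[x]\<close>.
\<close>

lemma derivation_extension_of_vanishing:
  assumes "derivation_on M D" "subring_of_reals M"
    and van: "\<And>p. coeffs_in M p \<Longrightarrow> poly p x = 0 \<Longrightarrow> derivation_of_value D x v p = 0"
  shows "\<exists>N E. derivation_on N E \<and> subring_of_reals N \<and> M \<subseteq> N \<and> x \<in> N \<and>
           (\<forall>a\<in>M. E a = D a) \<and> E x = v"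
proof -
  note D0 = derivation_basic[OF assms(1,2)] and ci = coeffs_in_closed[OF assms(2)]
  define N where "N = {poly p x | p. coeffs_in M p}"
  define E where "E y = derivation_of_value D x v (SOME p. coeffs_in M p \<and> poly p x = y)" for y
  have E: "E (poly p x) = derivation_of_value D x v p" if p: "coeffs_in M p" for p
  proof -
    define q where "q = (SOME q. coeffs_in M q \<and> poly q x = poly p x)"
    have q: "coeffs_in M q \<and> poly q x = poly p x"
      unfolding q_def by (rule someI[of _ p]) (use p in simp)
    have "derivation_of_value D x v (q - p) = 0"
      using q p by (intro van) (auto intro: ci)
    then show ?thesis
      using q p derivation_of_value_add_diff(2)[OF assms(1,2), of q p] by (simp add: E_def q_def)
  qed
  have sub: "subring_of_reals N"
    unfolding subring_of_reals_def
  proof (intro conjI ballI)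
    have "poly [:1:] x \<in> N"
      unfolding N_def using ci(5)[of 1] subring_closed[OF assms(2)] by blast
    then show "1 \<in> N" by simp
  next
    fix a b assume "a \<in> N" "b \<in> N"
    then obtain p q where "coeffs_in M p" "coeffs_in M q" "a = poly p x" "b = poly q x"
      unfolding N_def by blast
    then have "a - b = poly (p - q) x" "a * b = poly (p * q) x" "coeffs_in M (p - q)" "coeffs_in M (p * q)"
      by (auto intro: ci)
    then show "a - b \<in> N" "a * b \<in> N" unfolding N_def by blast+
  qed
  have der: "derivation_on N E"
    unfolding derivation_on_def
  proof (intro ballI)
    fix a b assume "a \<in> N" "b \<in> N"
    then obtain p q where pq: "coeffs_in M p" "coeffs_in M q" "a = poly p x" "b = poly q x"
      unfolding N_def by blast
    have "E (poly (p + q) x) = E a + E b"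
      using pq by (subst E) (auto simp: E intro: ci derivation_of_value_add_diff[OF assms(1,2)])
    moreover have "E (poly (p * q) x) = a * E b + E a * b"
      using pq by (subst E) (auto simp: E intro: ci derivation_of_value_mult[OF assms(1,2)])
    ultimately show "E (a + b) = E a + E b \<and> E (a * b) = a * E b + E a * b"
      using pq by simp
  qed
  have const: "a \<in> N \<and> E a = D a" if "a \<in> M" for a
  proof -
    have "coeffs_in M [:a:]" using that by (rule ci)
    then have "poly [:a:] x \<in> N" "E (poly [:a:] x) = derivation_of_value D x v [:a:]"
      using E unfolding N_def by blast+
    then show ?thesis
      by (simp add: derivation_of_value_def map_poly_pCons D0)
  qed
  have "poly [:0, 1:] x \<in> N" "E (poly [:0, 1:] x) = derivation_of_value D x v [:0, 1:]"
    using E ci(6) unfolding N_def by blast+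
  then have "x \<in> N" "E x = v"
    by (simp_all add: derivation_of_value_def map_poly_pCons D0 pderiv_pCons)
  with sub der const show ?thesis by blast
qed

text \<open>
  If \<open>x\<close> is transcendental over \<open>M\<close>, any value of \<open>D x\<close> will do. If \<open>x\<close> is algebraic, a nonzero
  polynomial \<open>p\<close> over \<open>M\<close> of least degree that vanishes at \<open>x\<close> has \<open>p' x \<noteq> 0\<close> and forces the value of \<open>D x\<close>;
  division with remainder by \<open>p\<close>, done without fractions since \<open>M\<close> is only a ring, carries the
  vanishing condition over from \<open>p\<close> to all other polynomials.
\<close>

lemma derivation_extension:
  assumes "derivation_on M D" "subring_of_reals M"
  shows "\<exists>N E. derivation_on N E \<and> subring_of_reals N \<and> M \<subseteq> N \<and> x \<in> N \<and> (\<forall>a\<in>M. E a = D a)"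
proof -
  note D0 = derivation_basic[OF assms] and ci = coeffs_in_closed[OF assms(2)]
  have "\<exists>v. \<forall>p. coeffs_in M p \<longrightarrow> poly p x = 0 \<longrightarrow> derivation_of_value D x v p = 0"
  proof (cases "\<exists>p. p \<noteq> 0 \<and> coeffs_in M p \<and> poly p x = 0")
    case False
    then have "derivation_of_value D x 0 p = 0" if "coeffs_in M p" "poly p x = 0" for p
      using that by (auto simp: derivation_of_value_def)
    then show ?thesis by blast
  next
    case True
    define R where "R p \<longleftrightarrow> p \<noteq> 0 \<and> coeffs_in M p \<and> poly p x = 0" for p
    obtain p where p: "R p" and min: "\<And>q. R q \<Longrightarrow> degree p \<le> degree q"
      using True ex_has_least_nat[of R _ degree] unfolding R_def by blast
    note p' = p[unfolded R_def]
    define c where "c = lead_coeff p"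
    have c: "c \<noteq> 0" "c \<in> M" using p' by (auto simp: c_def coeffs_in_def)
    have pos: "degree p > 0"
    proof (rule ccontr)
      assume "\<not> degree p > 0"
      then obtain a where "p = [:a:]" by (metis degree_eq_zeroE gr_zeroI)
      then show False using p' by auto
    qed
    have p'x: "poly (pderiv p) x \<noteq> 0"
    proof
      assume 0: "poly (pderiv p) x = 0"
      have "of_nat k * a \<in> M" if "a \<in> M" for k and a :: real
        using that by (induction k) (auto simp: algebra_simps intro: subring_closed[OF assms(2)])
      then have "coeffs_in M (pderiv p)"
        using p' by (auto simp: coeffs_in_def coeff_pderiv simp del: of_nat_Suc)
      then have "R (pderiv p)" using 0 pos by (auto simp: R_def pderiv_eq_0_iff)
      from min[OF this] show False using pos by (simp add: degree_pderiv)
    qed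
    define v where "v = - poly (map_poly D p) x / poly (pderiv p) x"
    have vp: "derivation_of_value D x v p = 0"
      using p'x by (simp add: derivation_of_value_def v_def)
    have "derivation_of_value D x v q = 0" if "coeffs_in M q" "poly q x = 0" for q
      using that
    proof (induction "degree q" arbitrary: q rule: less_induct)
      case less
      show ?case
      proof (cases "q = 0")
        case True
        then show ?thesis by (simp add: derivation_of_value_def)
      next
        case False
        then have "R q" using less by (simp add: R_def)
        then have le: "degree p \<le> degree q" by (rule min)
        define m where "m = monom (lead_coeff q) (degree q - degree p)"
        \<comment> \<open>One step of pseudo-division: the factor \<open>c\<close> avoids dividing by the leading coefficient of \<open>p\<close>.\<close>
        define r where "r = [:c:] * q - m * p"
        have m: "coeffs_in M m" using less unfolding m_def by (intro ci) (simp add: coeffs_in_def)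
        have dm: "degree m = degree q - degree p" "lead_coeff m = lead_coeff q" "m \<noteq> 0"
          using False unfolding m_def by (simp_all add: degree_monom_eq monom_eq_0_iff)
        have mp: "degree (m * p) = degree q"
          using dm p' le by (simp add: degree_mult_eq)
        have lmp: "lead_coeff (m * p) = lead_coeff q * c"
          unfolding lead_coeff_mult dm(2) c_def ..
        have cq: "degree ([:c:] * q) = degree q" using c by simp
        have r: "coeffs_in M r" "poly r x = 0"
          unfolding r_def using less m p' c by (auto intro!: ci simp del: mult_pCons_left)
        have "derivation_of_value D x v r = 0"
        proof (cases "r = 0")
          case True
          then show ?thesis by (simp add: derivation_of_value_def)
        next
          case False
          have "degree r \<le> degree q"
            unfolding r_def by (rule degree_diff_le) (simp_all only: mp cq order.refl)
          moreover have "coeff r (degree q) = 0"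
            using lmp mp unfolding r_def by simp
          ultimately have "degree r < degree q"
            using False by (metis le_neq_implies_less leading_coeff_0_iff)
          then show ?thesis using less r by blast
        qed
        moreover have "derivation_of_value D x v r = c * derivation_of_value D x v q"
        proof -
          have "derivation_of_value D x v r =
              derivation_of_value D x v ([:c:] * q) - derivation_of_value D x v (m * p)"
            unfolding r_def using less m p' c
            by (intro derivation_of_value_add_diff[OF assms] ci) auto
          also have "derivation_of_value D x v (m * p) = 0"
            using vp p' m by (subst derivation_of_value_mult[OF assms]) auto
          also have "derivation_of_value D x v ([:c:] * q) = c * derivation_of_value D x v q"
            using less c by (subst derivation_of_value_mult[OF assms]) (auto intro: ci)
          finally show ?thesis by simp
        qed
        ultimately show ?thesis using c by simp
      qed
    qed
    then show ?thesis by blast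
  qed
  then obtain v where "\<And>p. coeffs_in M p \<Longrightarrow> poly p x = 0 \<Longrightarrow> derivation_of_value D x v p = 0"
    by blast
  from derivation_extension_of_vanishing[OF assms this] show ?thesis by blast
qed

lemma derivation_extension_finite:
  assumes "finite W" "derivation_on M D" "subring_of_reals M"
  shows "\<exists>N E. derivation_on N E \<and> subring_of_reals N \<and> M \<subseteq> N \<and> W \<subseteq> N \<and> (\<forall>a\<in>M. E a = D a)"
  using assms(1)
proof (induction W)
  case empty
  then show ?case using assms(2,3) by blast
next
  case (insert w W)
  then obtain N E where N: "derivation_on N E" "subring_of_reals N" "M \<subseteq> N" "W \<subseteq> N" "\<forall>a\<in>M. E a = D a"
    by blast
  from derivation_extension[OF N(1,2), of w] obtain N' E' where
    "derivation_on N' E'" "subring_of_reals N'" "N \<subseteq> N'" "w \<in> N'" "\<forall>a\<in>N. E' a = E a"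
    by blast
  with N show ?case by (intro exI[of _ N'] exI[of _ E']) auto
qed

lemma derivation_of_transcendental:
  assumes k: "subring_of_reals k" and \<alpha>: "\<And>p. coeffs_in k p \<Longrightarrow> poly p \<alpha> = 0 \<Longrightarrow> p = 0"
    and W: "finite W"
  shows "\<exists>N E. derivation_on N E \<and> subring_of_reals N \<and> k \<subseteq> N \<and> W \<subseteq> N \<and> (\<forall>a\<in>k. E a = 0) \<and> E \<alpha> = 1"
proof -
  have "derivation_on k (\<lambda>_. 0)" by (simp add: derivation_on_def)
  moreover have "derivation_of_value (\<lambda>_. 0) \<alpha> 1 p = 0" if "coeffs_in k p" "poly p \<alpha> = 0" for p
    using \<alpha>[OF that] by (simp add: derivation_of_value_def)
  ultimately obtain M D where M: "derivation_on M D" "subring_of_reals M" "k \<subseteq> M" "\<alpha> \<in> M"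
      "\<forall>a\<in>k. D a = 0" "D \<alpha> = 1"
    using derivation_extension_of_vanishing[of k "\<lambda>_. 0" \<alpha> 1] k by auto
  from derivation_extension_finite[OF W M(1,2)] obtain N E where
    "derivation_on N E" "subring_of_reals N" "M \<subseteq> N" "W \<subseteq> N" "\<forall>a\<in>M. E a = D a" by blast
  with M show ?thesis by (intro exI[of _ N] exI[of _ E]) auto
qed

text \<open>Closing up under subtraction and multiplication in countably many rounds.\<close>

lemma countable_subring:
  assumes "countable C"
  shows "\<exists>k. subring_of_reals k \<and> countable k \<and> C \<subseteq> k"
proof -
  define R where "R = rec_nat (insert 1 C)
     (\<lambda>_ S. S \<union> (\<lambda>(a, b). a - b) ` (S \<times> S) \<union> (\<lambda>(a, b). a * b) ` (S \<times> S))"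
  have R0: "R 0 = insert 1 C" and RS: "\<And>n. R (Suc n) =
      R n \<union> (\<lambda>(a, b). a - b) ` (R n \<times> R n) \<union> (\<lambda>(a, b). a * b) ` (R n \<times> R n)"
    by (simp_all add: R_def)
  have "countable (R n)" for n
    by (induction n) (auto simp: R0 RS assms)
  moreover have "incseq R"
    by (rule incseq_SucI) (auto simp: RS)
  moreover have "subring_of_reals (\<Union>n. R n)"
    unfolding subring_of_reals_def
  proof (intro conjI ballI)
    show "1 \<in> (\<Union>n. R n)" using R0 by blast
    fix a b assume "a \<in> (\<Union>n. R n)" "b \<in> (\<Union>n. R n)"
    then obtain i j where "a \<in> R i" "b \<in> R j" by blast
    then have "a \<in> R (max i j)" "b \<in> R (max i j)"
      using \<open>incseq R\<close> by (meson incseqD max.cobounded1 max.cobounded2 subsetD)+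
    then have "a - b \<in> R (Suc (max i j))" "a * b \<in> R (Suc (max i j))"
      unfolding RS by force+
    then show "a - b \<in> (\<Union>n. R n)" "a * b \<in> (\<Union>n. R n)" by blast+
  qed
  ultimately show ?thesis using R0 by (intro exI[of _ "\<Union>n. R n"]) auto
qed

lemma countable_algebraic:
  assumes "countable k"
  shows "countable {\<alpha>. \<exists>p. p \<noteq> 0 \<and> coeffs_in k p \<and> poly p \<alpha> = 0}"
proof -
  have "{p. coeffs_in k p} \<subseteq> Poly ` lists k"
  proof
    fix p assume "p \<in> {p. coeffs_in k p}"
    then have "coeffs p \<in> lists k"
      by (auto simp: coeffs_in_def coeffs_def)
    then show "p \<in> Poly ` lists k" by (metis Poly_coeffs imageI)
  qed
  then have "countable {p. coeffs_in k p}"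
    by (rule countable_subset) (intro countable_image countable_lists assms)
  then have "countable {p. p \<noteq> 0 \<and> coeffs_in k p}"
    by (rule countable_subset[rotated]) auto
  then have "countable (\<Union>p\<in>{p. p \<noteq> 0 \<and> coeffs_in k p}. {\<alpha>. poly p \<alpha> = 0})"
    by (rule countable_UN) (auto intro: countable_finite poly_roots_finite)
  then show ?thesis by (rule countable_subset[rotated]) auto
qed

section \<open>Polynomial functions and their partial derivatives\<close>

text \<open>
  Points are functions on an index type, of which only the coordinates in \<open>V\<close> are read: the number of
  variables that is needed later depends on the set of active constraints, so it cannot be the
  dimension of a type. The set \<open>C\<close> holds the constants from which the polynomial is built, and \<open>D\<close> is
  an upper bound of its degree.
\<close>

inductive polyfun :: "'v set \<Rightarrow> real set \<Rightarrow> nat \<Rightarrow> (('v \<Rightarrow> real) \<Rightarrow> real) \<Rightarrow> bool"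
  for V C where
  const: "c \<in> C \<Longrightarrow> polyfun V C 0 (\<lambda>x. c)"
| var: "v \<in> V \<Longrightarrow> polyfun V C 1 (\<lambda>x. x v)"
| add: "polyfun V C D f \<Longrightarrow> polyfun V C D g \<Longrightarrow> polyfun V C D (\<lambda>x. f x + g x)"
| mult: "polyfun V C D f \<Longrightarrow> polyfun V C E g \<Longrightarrow> polyfun V C (D + E) (\<lambda>x. f x * g x)"
| weaken: "polyfun V C D f \<Longrightarrow> D \<le> E \<Longrightarrow> polyfun V C E f"

definition has_partial :: "'v \<Rightarrow> (('v \<Rightarrow> real) \<Rightarrow> real) \<Rightarrow> (('v \<Rightarrow> real) \<Rightarrow> real) \<Rightarrow> bool" where
  "has_partial v f f' \<longleftrightarrow>
     (\<forall>x. ((\<lambda>t. f (x(v := t))) has_real_derivative f' x) (at (x v)))"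

lemma has_partial_unique:
  assumes "has_partial v f f'" "has_partial v f f''"
  shows "f' = f''"
  using assms unfolding has_partial_def by (auto intro!: ext DERIV_unique)

lemma has_partial_intros:
  shows "has_partial v (\<lambda>x. c) (\<lambda>x. 0)"
    and "has_partial v (\<lambda>x. x v) (\<lambda>x. 1)"
    and "v \<noteq> w \<Longrightarrow> has_partial v (\<lambda>x. x w) (\<lambda>x. 0)"
    and "has_partial v f f' \<Longrightarrow> has_partial v g g' \<Longrightarrow> has_partial v (\<lambda>x. f x + g x) (\<lambda>x. f' x + g' x)"
    and "has_partial v f f' \<Longrightarrow> has_partial v g g' \<Longrightarrow> has_partial v (\<lambda>x. f x - g x) (\<lambda>x. f' x - g' x)"
    and "has_partial v f f' \<Longrightarrow> has_partial v g g' \<Longrightarrow>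
      has_partial v (\<lambda>x. f x * g x) (\<lambda>x. f x * g' x + f' x * g x)"
  unfolding has_partial_def
proof -
  assume f: "\<forall>x. ((\<lambda>t. f (x(v := t))) has_real_derivative f' x) (at (x v))"
    and g: "\<forall>x. ((\<lambda>t. g (x(v := t))) has_real_derivative g' x) (at (x v))"
  show "\<forall>x. ((\<lambda>t. f (x(v := t)) + g (x(v := t))) has_real_derivative f' x + g' x) (at (x v))"
    using f g by (auto intro: DERIV_add)
  show "\<forall>x. ((\<lambda>t. f (x(v := t)) - g (x(v := t))) has_real_derivative f' x - g' x) (at (x v))"
    using f g by (auto intro: DERIV_diff)
  show "\<forall>x. ((\<lambda>t. f (x(v := t)) * g (x(v := t))) has_real_derivative f x * g' x + f' x * g x) (at (x v))"
  proof
    fix x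
    show "((\<lambda>t. f (x(v := t)) * g (x(v := t))) has_real_derivative f x * g' x + f' x * g x) (at (x v))"
      using DERIV_mult[OF f[rule_format, of x] g[rule_format, of x]] by (simp add: algebra_simps)
  qed
qed auto

lemma has_partial_sum:
  assumes "\<And>i. i \<in> A \<Longrightarrow> has_partial v (f i) (f' i)"
  shows "has_partial v (\<lambda>x. \<Sum>i\<in>A. f i x) (\<lambda>x. \<Sum>i\<in>A. f' i x)"
  using assms by (induction A rule: infinite_finite_induct) (auto intro: has_partial_intros)

lemma polyfun_minus: "polyfun V UNIV D f \<Longrightarrow> polyfun V UNIV D (\<lambda>x. - f x)"
  using polyfun.mult[OF polyfun.const[of "-1" UNIV V], of D f] by simp

lemma polyfun_diff:
  "polyfun V UNIV D f \<Longrightarrow> polyfun V UNIV D g \<Longrightarrow> polyfun V UNIV D (\<lambda>x. f x - g x)"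
  using polyfun.add[OF _ polyfun_minus, of V D f g] by simp

lemma polyfun_const: "polyfun V UNIV D (\<lambda>x. c)"
  by (rule polyfun.weaken[OF polyfun.const]) auto

lemma polyfun_cmult: "polyfun V UNIV D f \<Longrightarrow> polyfun V UNIV D (\<lambda>x. c * f x)"
  using polyfun.mult[OF polyfun_const[of V 0]] by force

lemma polyfun_sum:
  "(\<And>i. i \<in> A \<Longrightarrow> polyfun V UNIV D (f i)) \<Longrightarrow> polyfun V UNIV D (\<lambda>x. \<Sum>i\<in>A. f i x)"
  by (induction A rule: infinite_finite_induct) (auto intro: polyfun.add polyfun_const)

lemma polyfun_power: "polyfun V UNIV D f \<Longrightarrow> polyfun V UNIV (n * D) (\<lambda>x. f x ^ n)"
  by (induction n) (auto intro: polyfun.mult polyfun_const)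

lemma polyfun_prod:
  "(\<And>i. i \<in> A \<Longrightarrow> polyfun V UNIV (D i) (f i)) \<Longrightarrow>
     polyfun V UNIV (\<Sum>i\<in>A. D i) (\<lambda>x. \<Prod>i\<in>A. f i x)"
  by (induction A rule: infinite_finite_induct) (auto intro: polyfun.mult polyfun_const)

lemma polyfun_cong_vars:
  assumes "polyfun V C D f" "\<And>v. v \<in> V \<Longrightarrow> x v = y v"
  shows "f x = f y"
  using assms by (induction rule: polyfun.induct) auto

lemma polyfun_coeffs_mono:
  assumes "polyfun V C D f" "C \<subseteq> C'"
  shows "polyfun V C' D f"
  using assms by (induction rule: polyfun.induct) (auto intro: polyfun.intros)

lemma polyfun_countable_coeffs:
  assumes "polyfun V UNIV D f"
  shows "\<exists>C. countable C \<and> polyfun V C D f"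
  using assms
proof (induction rule: polyfun.induct)
  case (const c)
  then show ?case by (intro exI[of _ "{c}"]) (auto intro: polyfun.intros)
next
  case (var v)
  then show ?case by (intro exI[of _ "{}"]) (auto intro: polyfun.intros)
next
  case (add D f g)
  then obtain C1 C2 where "countable C1" "countable C2" "polyfun V C1 D f" "polyfun V C2 D g" by blast
  then show ?case
    by (intro exI[of _ "C1 \<union> C2"]) (auto intro!: polyfun.add intro: polyfun_coeffs_mono)
next
  case (mult D f E g)
  then obtain C1 C2 where "countable C1" "countable C2" "polyfun V C1 D f" "polyfun V C2 E g" by blast
  then show ?case
    by (intro exI[of _ "C1 \<union> C2"]) (auto intro!: polyfun.mult intro: polyfun_coeffs_mono)
next
  case (weaken D f E)
  then show ?case by (meson polyfun.weaken)
qed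

lemma polyfun_continuous:
  assumes "polyfun V C D f"
  shows "continuous_on UNIV f"
  using assms by (induction rule: polyfun.induct) (auto intro!: continuous_intros)

lemma polyfun_has_partial:
  assumes "polyfun V UNIV D f"
  shows "\<exists>f'. has_partial v f f' \<and> polyfun V UNIV (D - 1) f' \<and> (D = 0 \<longrightarrow> f' = (\<lambda>x. 0))"
  using assms
proof (induction rule: polyfun.induct)
  case (const c)
  then show ?case by (intro exI[of _ "\<lambda>x. 0"]) (auto intro: has_partial_intros polyfun_const)
next
  case (var w)
  show ?case
  proof (cases "v = w")
    case True
    then show ?thesis by (intro exI[of _ "\<lambda>x. 1"]) (auto intro: has_partial_intros polyfun_const)
  next
    case False
    then show ?thesis by (intro exI[of _ "\<lambda>x. 0"]) (auto intro: has_partial_intros polyfun_const)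
  qed
next
  case (add D f g)
  then obtain f' g' where "has_partial v f f'" "polyfun V UNIV (D - 1) f'" "D = 0 \<longrightarrow> f' = (\<lambda>x. 0)"
    "has_partial v g g'" "polyfun V UNIV (D - 1) g'" "D = 0 \<longrightarrow> g' = (\<lambda>x. 0)" by blast
  then show ?case
    by (intro exI[of _ "\<lambda>x. f' x + g' x"]) (auto intro: has_partial_intros polyfun.add)
next
  case (mult D f E g)
  then obtain f' g' where f': "has_partial v f f'" "polyfun V UNIV (D - 1) f'" "D = 0 \<longrightarrow> f' = (\<lambda>x. 0)"
    and g': "has_partial v g g'" "polyfun V UNIV (E - 1) g'" "E = 0 \<longrightarrow> g' = (\<lambda>x. 0)" by blast
  have "polyfun V UNIV (D + E - 1) (\<lambda>x. f x * g' x)"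
  proof (cases "E = 0")
    case True
    then show ?thesis using g' polyfun_const[of V _ 0] by simp
  next
    case False
    then show ?thesis using polyfun.mult[OF mult.hyps(1) g'(2)] by simp
  qed
  moreover have "polyfun V UNIV (D + E - 1) (\<lambda>x. f' x * g x)"
  proof (cases "D = 0")
    case True
    then show ?thesis using f' polyfun_const[of V _ 0] by simp
  next
    case False
    then show ?thesis using polyfun.mult[OF f'(2) mult.hyps(2)] by simp
  qed
  ultimately have "polyfun V UNIV (D + E - 1) (\<lambda>x. f x * g' x + f' x * g x)"
    by (rule polyfun.add)
  with f' g' show ?case
    by (intro exI[of _ "\<lambda>x. f x * g' x + f' x * g x"]) (auto intro: has_partial_intros)
next
  case (weaken D f E)
  then obtain f' where f': "has_partial v f f'" "polyfun V UNIV (D - 1) f'" "D = 0 \<longrightarrow> f' = (\<lambda>x. 0)"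
    by blast
  have "polyfun V UNIV (E - 1) f'"
    by (rule polyfun.weaken[OF f'(2)]) (use weaken.hyps in simp)
  with f' weaken.hyps show ?case by (intro exI[of _ f']) auto
qed

lemma polyfun_partial:
  assumes "polyfun V UNIV (Suc D) f" "has_partial v f f'"
  shows "polyfun V UNIV D f'"
  using polyfun_has_partial[OF assms(1), of v] has_partial_unique[OF assms(2)] by auto

text \<open>
  By induction on the construction of \<open>f\<close>, since derivations obey the same sum and product rules as
  partial derivatives.
\<close>

lemma derivation_chain_rule:
  assumes "polyfun V C D f" "finite V"
    and E: "derivation_on M E" "subring_of_reals M"
    and C: "C \<subseteq> M" "\<And>c. c \<in> C \<Longrightarrow> E c = 0"
    and z: "\<And>v. v \<in> V \<Longrightarrow> z v \<in> M"
  shows "f z \<in> M \<and> (\<exists>f'. (\<forall>v. has_partial v f (f' v)) \<and> E (f z) = (\<Sum>v\<in>V. f' v z * E (z v)))"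
  using assms(1)
proof (induction rule: polyfun.induct)
  case (const c)
  then show ?case
    using C by (auto intro!: exI[of _ "\<lambda>v x. 0"] has_partial_intros)
next
  case (var w)
  define f' where "f' = (\<lambda>v (x :: 'a \<Rightarrow> real). if v = w then 1 else 0 :: real)"
  have "has_partial v (\<lambda>x. x w) (f' v)" for v
    unfolding f'_def by (cases "v = w") (auto intro: has_partial_intros)
  moreover have "E (z w) = (\<Sum>v\<in>V. f' v z * E (z v))"
    using var assms(2) by (simp add: f'_def if_distrib[of "\<lambda>c. c * _"] cong: if_cong)
  ultimately show ?case using var z by blast
next
  case (add D f g)
  then obtain f' g' where f': "\<forall>v. has_partial v f (f' v)" "E (f z) = (\<Sum>v\<in>V. f' v z * E (z v))"
    and g': "\<forall>v. has_partial v g (g' v)" "E (g z) = (\<Sum>v\<in>V. g' v z * E (z v))" by blast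
  have "E (f z + g z) = E (f z) + E (g z)"
    using add E by (simp add: derivation_on_def)
  also have "\<dots> = (\<Sum>v\<in>V. (f' v z + g' v z) * E (z v))"
    by (simp add: f' g' sum.distrib algebra_simps)
  finally show ?case
    using f' g' add subring_closed[OF E(2)]
    by (auto intro!: exI[of _ "\<lambda>v x. f' v x + g' v x"] has_partial_intros)
next
  case (mult D f D' g)
  then obtain f' g' where f': "\<forall>v. has_partial v f (f' v)" "E (f z) = (\<Sum>v\<in>V. f' v z * E (z v))"
    and g': "\<forall>v. has_partial v g (g' v)" "E (g z) = (\<Sum>v\<in>V. g' v z * E (z v))" by blast
  have "E (f z * g z) = f z * E (g z) + E (f z) * g z"
    using mult E by (simp add: derivation_on_def)
  also have "\<dots> = (\<Sum>v\<in>V. (f z * g' v z + f' v z * g z) * E (z v))"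
    unfolding f' g' sum_distrib_left sum_distrib_right sum.distrib[symmetric]
    by (intro sum.cong) (auto simp: algebra_simps)
  finally show ?case
    using f' g' mult subring_closed[OF E(2)]
    by (auto intro!: exI[of _ "\<lambda>v x. f x * g' v x + f' v x * g x"] has_partial_intros)
qed

section \<open>Critical values are algebraic over the coefficients\<close>

text \<open>
  A Sard theorem for polynomials, proved by algebra. If \<open>\<alpha> = F z\<close> were transcendental over a countable
  ring \<open>k\<close> that contains the coefficients of \<open>F\<close>, some derivation \<open>E\<close> would vanish on \<open>k\<close> and have
  \<open>E \<alpha> = 1\<close>; but the chain rule expresses \<open>E (F z)\<close> through the partial derivatives of \<open>F\<close> at \<open>z\<close>,
  all of which vanish.
\<close>

lemma countable_critical_values:
  assumes V: "finite V" and F: "polyfun V UNIV D F"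
    and F': "\<And>v. v \<in> V \<Longrightarrow> has_partial v F (F' v)"
  shows "countable {F z | z. \<forall>v\<in>V. F' v z = 0}"
proof -
  obtain C where C: "countable C" "polyfun V C D F" using polyfun_countable_coeffs[OF F] by blast
  obtain k where k: "subring_of_reals k" "countable k" "C \<subseteq> k" using countable_subring[OF C(1)] by blast
  have "\<exists>p. p \<noteq> 0 \<and> coeffs_in k p \<and> poly p (F z) = 0" if z: "\<forall>v\<in>V. F' v z = 0" for z
  proof (rule ccontr)
    assume "\<not> ?thesis"
    then have tr: "\<And>p. coeffs_in k p \<Longrightarrow> poly p (F z) = 0 \<Longrightarrow> p = 0" by blast
    have "finite (z ` V)" using V by simp
    from derivation_of_transcendental[OF k(1) tr this] obtain M E where
      M: "derivation_on M E" "subring_of_reals M" "k \<subseteq> M" "z ` V \<subseteq> M" "\<forall>a\<in>k. E a = 0" "E (F z) = 1"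
      by blast
    obtain f' where f': "\<forall>v. has_partial v F (f' v)" "E (F z) = (\<Sum>v\<in>V. f' v z * E (z v))"
      using derivation_chain_rule[OF C(2) V M(1,2), of z] M(3-5) k(3) by blast
    have "f' v z = 0" if "v \<in> V" for v
      using has_partial_unique[OF F'[OF that]] f'(1) z that by metis
    then show False using f'(2) M(6) by simp
  qed
  then show ?thesis
    by (intro countable_subset[OF _ countable_algebraic[OF k(2)]]) auto
qed

section \<open>Algebraic relations between polynomials\<close>

text \<open>Gaussian elimination: each equation serves to remove one of the unknowns that occur in it.\<close>

lemma homogeneous_system_nontrivial_solution:
  fixes m :: "'s \<Rightarrow> 'e \<Rightarrow> real"
  assumes "finite E" "finite S" "card E < card S"
  shows "\<exists>c. (\<exists>s\<in>S. c s \<noteq> 0) \<and> (\<forall>e\<in>E. (\<Sum>s\<in>S. c s * m s e) = 0)"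
  using assms
proof (induction E arbitrary: S m rule: finite_induct)
  case empty
  then obtain s where "s \<in> S" by fastforce
  then show ?case by (intro exI[of _ "\<lambda>_. 1"]) auto
next
  case (insert e E)
  show ?case
  proof (cases "\<forall>s\<in>S. m s e = 0")
    case True
    have "card E < card S" using insert by simp
    from insert.IH[OF insert.prems(1) this, of m] True show ?thesis by auto
  next
    case False
    then obtain s0 where s0: "s0 \<in> S" "m s0 e \<noteq> 0" by blast
    define S' where "S' = S - {s0}"
    define m' where "m' = (\<lambda>s e'. m s e' - m s e / m s0 e * m s0 e')"
    have S: "S = insert s0 S'" "s0 \<notin> S'" "finite S'"
      using s0 insert.prems by (auto simp: S'_def)
    have "card E < card S'" using insert S by simp
    from insert.IH[OF S(3) this, of m'] obtain c where
      c: "\<exists>s\<in>S'. c s \<noteq> 0" "\<And>e'. e' \<in> E \<Longrightarrow> (\<Sum>s\<in>S'. c s * m' s e') = 0" by blast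
    define c' where "c' = c(s0 := - (\<Sum>s\<in>S'. c s * m s e / m s0 e))"
    have c'S: "(\<Sum>s\<in>S. c' s * m s e') = (\<Sum>s\<in>S'. c s * m' s e')" for e'
    proof -
      have "(\<Sum>s\<in>S. c' s * m s e') = c' s0 * m s0 e' + (\<Sum>s\<in>S'. c' s * m s e')"
        using S by simp
      also have "(\<Sum>s\<in>S'. c' s * m s e') = (\<Sum>s\<in>S'. c s * m s e')"
        using S by (intro sum.cong) (auto simp: c'_def)
      also have "c' s0 * m s0 e' = - (\<Sum>s\<in>S'. c s * m s e / m s0 e * m s0 e')"
        by (simp add: c'_def sum_distrib_right)
      finally show ?thesis
        by (simp add: m'_def algebra_simps sum_subtractf)
    qed
    have "(\<Sum>s\<in>S'. c s * m' s e) = 0"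
      using s0 by (simp add: m'_def)
    then have "\<forall>e'\<in>insert e E. (\<Sum>s\<in>S. c' s * m s e') = 0"
      using c(2) c'S by auto
    moreover have "\<exists>s\<in>S. c' s \<noteq> 0"
      using c(1) S by (auto simp: c'_def)
    ultimately show ?thesis by blast
  qed
qed

definition monomial :: "'v set \<Rightarrow> ('v \<Rightarrow> nat) \<Rightarrow> ('v \<Rightarrow> real) \<Rightarrow> real" where
  "monomial V a x = (\<Prod>v\<in>V. x v ^ a v)"

definition exponents :: "'v set \<Rightarrow> nat \<Rightarrow> ('v \<Rightarrow> nat) set" where
  "exponents V L = {a. (\<forall>v. v \<notin> V \<longrightarrow> a v = 0) \<and> sum a V \<le> L}"

text \<open>Stars and bars: splitting off the exponent of one variable leads to the hockey-stick identity.\<close>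

lemma card_exponents:
  assumes "finite V"
  shows "finite (exponents V L) \<and> card (exponents V L) = (card V + L) choose card V"
  using assms
proof (induction V arbitrary: L)
  case empty
  have "exponents {} L = {\<lambda>_ :: 'a. 0 :: nat}" by (auto simp: exponents_def)
  then show ?case by simp
next
  case (insert v V)
  define S where "S = (SIGMA j:{..L}. exponents V (L - j))"
  have "bij_betw (\<lambda>(j, a). a(v := j)) S (exponents (insert v V) L)"
  proof (rule bij_betwI[of _ _ _ "\<lambda>a. (a v, a(v := 0))"])
    have s: "sum (a(v := j)) V = sum a V" for a :: "'a \<Rightarrow> nat" and j
      using insert by (intro sum.cong) auto
    show "(\<lambda>(j, a). a(v := j)) \<in> S \<rightarrow> exponents (insert v V) L"
      using insert s by (auto simp: S_def exponents_def)
    show "(\<lambda>a. (a v, a(v := 0))) \<in> exponents (insert v V) L \<rightarrow> S"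
      using insert s by (auto simp: S_def exponents_def)
    show "((case x of (j, a) \<Rightarrow> a(v := j)) v, (case x of (j, a) \<Rightarrow> a(v := j))(v := 0)) = x"
      if "x \<in> S" for x
      using that insert by (auto simp: S_def exponents_def fun_eq_iff)
    show "(case (y v, y(v := 0)) of (j, a) \<Rightarrow> a(v := j)) = y" for y by auto
  qed
  moreover have fin: "finite S" using insert.IH by (auto simp: S_def)
  moreover have "card S = (card (insert v V) + L) choose card (insert v V)"
  proof -
    have "card S = (\<Sum>j\<le>L. card (exponents V (L - j)))"
      unfolding S_def by (rule card_SigmaI) (use insert.IH in auto)
    also have "\<dots> = (\<Sum>j\<le>L. (card V + (L - j)) choose card V)" using insert.IH by simp
    also have "\<dots> = (\<Sum>j\<le>L. (card V + j) choose card V)"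
      by (rule sum.reindex_bij_witness[of _ "\<lambda>j. L - j" "\<lambda>j. L - j"]) auto
    also have "\<dots> = (card V + L + 1) choose (card V + 1)" by (rule choose_rising_sum)
    finally show ?thesis using insert by simp
  qed
  ultimately show ?case using bij_betw_finite bij_betw_same_card by metis
qed

definition monomial_combination :: "'v set \<Rightarrow> nat \<Rightarrow> (('v \<Rightarrow> real) \<Rightarrow> real) \<Rightarrow> bool" where
  "monomial_combination V L f \<longleftrightarrow> (\<exists>c. f = (\<lambda>x. \<Sum>a\<in>exponents V L. c a * monomial V a x))"

lemma monomial_combination_monomial:
  assumes "finite V" "a \<in> exponents V L"
  shows "monomial_combination V L (\<lambda>x. c * monomial V a x)"
  unfolding monomial_combination_def
  using assms card_exponents[OF assms(1), of L]
  by (intro exI[of _ "\<lambda>b. if b = a then c else 0"]) (auto simp: if_distrib[of "\<lambda>c. c * _"] cong: if_cong)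

lemma monomial_combination_add:
  assumes "monomial_combination V L f" "monomial_combination V L g"
  shows "monomial_combination V L (\<lambda>x. f x + g x)"
proof -
  from assms obtain c c' where "f = (\<lambda>x. \<Sum>a\<in>exponents V L. c a * monomial V a x)"
    "g = (\<lambda>x. \<Sum>a\<in>exponents V L. c' a * monomial V a x)"
    unfolding monomial_combination_def by blast
  then show ?thesis
    unfolding monomial_combination_def
    by (intro exI[of _ "\<lambda>a. c a + c' a"]) (auto simp: sum.distrib algebra_simps)
qed

lemma monomial_combination_sum:
  assumes "\<And>i. i \<in> A \<Longrightarrow> monomial_combination V L (f i)"
  shows "monomial_combination V L (\<lambda>x. \<Sum>i\<in>A. f i x)"
proof -
  have "monomial_combination V L (\<lambda>x. 0)"
    unfolding monomial_combination_def by (intro exI[of _ "\<lambda>_. 0"]) auto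
  then show ?thesis
    using assms
    by (induction A rule: infinite_finite_induct) (auto intro: monomial_combination_add)
qed

lemma polyfun_monomial_combination:
  assumes V: "finite V" and "polyfun V C D f"
  shows "monomial_combination V D f"
  using assms(2)
proof (induction rule: polyfun.induct)
  case (const c)
  then show ?case
    using monomial_combination_monomial[OF V, of "\<lambda>_. 0" 0 c] by (simp add: exponents_def monomial_def)
next
  case (var v)
  have "monomial V (\<lambda>w. if w = v then 1 else 0) x = x v" for x
    using V var by (simp add: monomial_def if_distrib[of "\<lambda>n. _ ^ n"] cong: if_cong)
  then show ?case
    using monomial_combination_monomial[OF V, of "\<lambda>w. if w = v then 1 else 0" 1 1] V var
    by (auto simp: exponents_def)
next
  case (add D f g)
  then show ?case by (intro monomial_combination_add)
next
  case (mult D f E g)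
  then obtain c c' where fg: "f = (\<lambda>x. \<Sum>a\<in>exponents V D. c a * monomial V a x)"
    "g = (\<lambda>x. \<Sum>a\<in>exponents V E. c' a * monomial V a x)"
    unfolding monomial_combination_def by blast
  have "(\<lambda>x. f x * g x) = (\<lambda>x. \<Sum>a\<in>exponents V D. \<Sum>b\<in>exponents V E.
      (c a * c' b) * monomial V (\<lambda>v. a v + b v) x)"
    unfolding fg monomial_def power_add prod.distrib sum_product
    by (intro ext sum.cong refl) (simp only: mult_ac)
  moreover have "monomial_combination V (D + E) (\<lambda>x. \<Sum>a\<in>exponents V D. \<Sum>b\<in>exponents V E.
      (c a * c' b) * monomial V (\<lambda>v. a v + b v) x)"
    by (intro monomial_combination_sum monomial_combination_monomial V)
      (auto simp: exponents_def sum.distrib)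
  ultimately show ?case by simp
next
  case (weaken D f E)
  then obtain c where "f = (\<lambda>x. \<Sum>a\<in>exponents V D. c a * monomial V a x)"
    unfolding monomial_combination_def by blast
  moreover have "monomial_combination V E (\<lambda>x. \<Sum>a\<in>exponents V D. c a * monomial V a x)"
    using weaken by (intro monomial_combination_sum monomial_combination_monomial V) (auto simp: exponents_def)
  ultimately show ?case by simp
qed

text \<open>
  Both binomial coefficients are polynomials of degree \<open>N\<close> in \<open>M\<close>, and the coefficient of \<open>M ^ N\<close> in the
  first is \<open>D ^ N\<close> times that in the second.
\<close>

lemma exponents_growth:
  "\<exists>M. (N + (D * M + T)) choose N < (D ^ N + 1) * ((N + M) choose N)"
proof -
  have lim: "(\<lambda>M. real (N + (D * M + T) - i) / real (N + M - i)) \<longlonglongrightarrow> real D" if "i < N" for i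
  proof -
    define c where "c = real N - real i"
    \<comment> \<open>Each factor of the quotient of the binomial coefficients is \<open>D\<close> plus a term of order \<open>1 / M\<close>.\<close>
    have "(\<lambda>M. real D + (c + real T - real D * c) / (c + real M)) \<longlonglongrightarrow> real D + 0"
      by (intro tendsto_add tendsto_const) real_asymp
    moreover have "real D + (c + real T - real D * c) / (c + real M) =
        real (N + (D * M + T) - i) / real (N + M - i)" for M
    proof -
      have "c + real M > 0" using that by (simp add: c_def)
      moreover have "real (N + (D * M + T) - i) = c + D * M + T" "real (N + M - i) = c + M"
        using that by (simp_all add: c_def of_nat_diff)
      ultimately show ?thesis by (simp add: field_simps)
    qed
    ultimately show ?thesis by simp
  qed
  have "(\<lambda>M. \<Prod>i<N. real (N + (D * M + T) - i) / real (N + M - i)) \<longlonglongrightarrow> (\<Prod>i<N. real D)"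
    by (intro tendsto_prod lim) simp
  moreover have "(\<Prod>i<N. real (N + (D * M + T) - i) / real (N + M - i)) =
      real ((N + (D * M + T)) choose N) / real ((N + M) choose N)" for M
    by (simp add: binomial_altdef_of_nat lessThan_atLeast0 prod_dividef)
  ultimately have "(\<lambda>M. real ((N + (D * M + T)) choose N) / real ((N + M) choose N)) \<longlonglongrightarrow> real (D ^ N)"
    by simp
  then have "\<forall>\<^sub>F M in sequentially. real ((N + (D * M + T)) choose N) / real ((N + M) choose N) < real (D ^ N + 1)"
    by (rule order_tendstoD) simp
  then obtain M where M: "real ((N + (D * M + T)) choose N) / real ((N + M) choose N) < real (D ^ N + 1)"
    by (auto simp: eventually_sequentially)
  have "real ((N + M) choose N) > 0" by simp
  with M have "real ((N + (D * M + T)) choose N) < real (D ^ N + 1) * real ((N + M) choose N)"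
    by (simp only: divide_less_eq if_True)
  then show ?thesis by (metis of_nat_less_iff of_nat_mult)
qed

text \<open>
  A dimension count. The products of a monomial of degree at most \<open>M\<close> in the
  \<open>f v\<close> with \<open>h ^ b\<close>, where \<open>b \<le> D ^ card V\<close>, are \<open>D ^ card V + 1\<close> times as many as the monomials of
  degree at most \<open>M\<close>, but they live in the space of polynomials of degree at most \<open>D * M\<close> plus a
  constant, whose dimension grows only \<open>D ^ card V\<close> times as fast as the number of these monomials.
\<close>

lemma polynomial_relation:
  assumes V: "finite V" and f: "\<And>v. v \<in> V \<Longrightarrow> polyfun V UNIV D (f v)" and h: "polyfun V UNIV H h"
  shows "\<exists>M c. (\<exists>a\<in>exponents V M. \<exists>b\<le>D ^ card V. c a b \<noteq> 0) \<and>
    (\<forall>x. (\<Sum>b\<le>D ^ card V. (\<Sum>a\<in>exponents V M. c a b * monomial V a (\<lambda>v. f v x)) * h x ^ b) = 0)"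
proof -
  define B where "B = D ^ card V"
  obtain M where M: "(card V + (D * M + H * B)) choose card V < (B + 1) * ((card V + M) choose card V)"
    using exponents_growth[of "card V" D "H * B"] unfolding B_def by blast
  define S where "S = exponents V M \<times> {..B}"
  define L where "L = D * M + H * B"
  have fin: "finite (exponents V L)" "finite S"
    using card_exponents[OF V] by (auto simp: S_def)
  have card: "card (exponents V L) < card S"
    using M card_exponents[OF V] by (auto simp: S_def L_def card_cartesian_product mult.commute)
  have comb: "monomial_combination V L (\<lambda>x. monomial V a (\<lambda>v. f v x) * h x ^ b)"
    if "(a, b) \<in> S" for a b
  proof -
    have "polyfun V UNIV ((\<Sum>v\<in>V. a v * D) + b * H) (\<lambda>x. (\<Prod>v\<in>V. f v x ^ a v) * h x ^ b)"
      by (intro polyfun.mult polyfun_prod polyfun_power f h)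
    moreover have "(\<Sum>v\<in>V. a v * D) + b * H \<le> L"
    proof -
      have "sum a V * D \<le> M * D" "b * H \<le> B * H"
        using that by (auto simp: S_def exponents_def intro: mult_le_mono1)
      then show ?thesis
        unfolding L_def sum_distrib_right[symmetric] mult.commute[of D] mult.commute[of H] by (rule add_mono)
    qed
    ultimately show ?thesis
      unfolding monomial_def by (rule polyfun_monomial_combination[OF V polyfun.weaken])
  qed
  have "\<forall>s\<in>S. \<exists>m. \<forall>x. monomial V (fst s) (\<lambda>v. f v x) * h x ^ snd s =
      (\<Sum>e\<in>exponents V L. m e * monomial V e x)"
  proof
    fix s assume "s \<in> S"
    then have "monomial_combination V L (\<lambda>x. monomial V (fst s) (\<lambda>v. f v x) * h x ^ snd s)"
      using comb[of "fst s" "snd s"] by simp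
    then show "\<exists>m. \<forall>x. monomial V (fst s) (\<lambda>v. f v x) * h x ^ snd s =
      (\<Sum>e\<in>exponents V L. m e * monomial V e x)"
      unfolding monomial_combination_def by meson
  qed
  then obtain m where m: "\<And>s x. s \<in> S \<Longrightarrow> monomial V (fst s) (\<lambda>v. f v x) * h x ^ snd s =
      (\<Sum>e\<in>exponents V L. m s e * monomial V e x)" by metis
  from homogeneous_system_nontrivial_solution[OF fin card, of m] obtain c where
    c: "\<exists>s\<in>S. c s \<noteq> 0" "\<And>e. e \<in> exponents V L \<Longrightarrow> (\<Sum>s\<in>S. c s * m s e) = 0" by blast
  have "(\<Sum>b\<le>B. (\<Sum>a\<in>exponents V M. c (a, b) * monomial V a (\<lambda>v. f v x)) * h x ^ b) = 0" for x
  proof -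
    have "(\<Sum>b\<le>B. (\<Sum>a\<in>exponents V M. c (a, b) * monomial V a (\<lambda>v. f v x)) * h x ^ b) =
        (\<Sum>a\<in>exponents V M. \<Sum>b\<le>B. c (a, b) * (monomial V a (\<lambda>v. f v x) * h x ^ b))"
      unfolding sum_distrib_right by (subst sum.swap) (simp add: algebra_simps)
    also have "\<dots> = (\<Sum>s\<in>S. c s * (monomial V (fst s) (\<lambda>v. f v x) * h x ^ snd s))"
      unfolding S_def by (simp add: sum.cartesian_product case_prod_beta)
    also have "\<dots> = (\<Sum>s\<in>S. \<Sum>e\<in>exponents V L. c s * m s e * monomial V e x)"
      by (intro sum.cong refl) (simp add: m sum_distrib_left mult.assoc)
    also have "\<dots> = (\<Sum>e\<in>exponents V L. (\<Sum>s\<in>S. c s * m s e) * monomial V e x)"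
      unfolding sum_distrib_right by (rule sum.swap)
    also have "\<dots> = 0" using c(2) by simp
    finally show ?thesis .
  qed
  moreover have "\<exists>a\<in>exponents V M. \<exists>b\<le>B. c (a, b) \<noteq> 0"
    using c(1) by (auto simp: S_def)
  ultimately show ?thesis unfolding B_def by (intro exI[of _ M] exI[of _ "\<lambda>a b. c (a, b)"]) auto
qed

text \<open>
  By induction on the set of variables: once the other variables have suitable values, the sum is a
  nonzero polynomial in the last one, which has finitely many roots. The last assumption says that
  distinct elements of \<open>A\<close> are distinct monomials in the variables \<open>V\<close>.
\<close>

lemma nonvanishing_near_zero:
  fixes c :: "('v \<Rightarrow> nat) \<Rightarrow> real"
  assumes "finite V" "finite A" "a0 \<in> A" "c a0 \<noteq> 0" "\<eta> > 0"
    and "\<And>a b. a \<in> A \<Longrightarrow> b \<in> A \<Longrightarrow> (\<And>v. v \<in> V \<Longrightarrow> a v = b v) \<Longrightarrow> a = b"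
  shows "\<exists>y. (\<forall>v\<in>V. \<bar>y v\<bar> < \<eta>) \<and> (\<Sum>a\<in>A. c a * monomial V a y) \<noteq> 0"
  using assms
proof (induction V arbitrary: A)
  case empty
  then have "A = {a0}" by blast
  then show ?case using empty by (simp add: monomial_def)
next
  case (insert v V)
  define A' where "A' = {a \<in> A. a v = a0 v}"
  have "\<exists>y. (\<forall>v\<in>V. \<bar>y v\<bar> < \<eta>) \<and> (\<Sum>a\<in>A'. c a * monomial V a y) \<noteq> 0"
  proof (rule insert.IH)
    show "a = b" if "a \<in> A'" "b \<in> A'" "\<And>v. v \<in> V \<Longrightarrow> a v = b v" for a b
      using that by (intro insert.prems(5)) (auto simp: A'_def)
  qed (use insert.prems in \<open>auto simp: A'_def\<close>)
  then obtain y where y: "\<forall>v\<in>V. \<bar>y v\<bar> < \<eta>" "(\<Sum>a\<in>A'. c a * monomial V a y) \<noteq> 0" by blast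
  define p where "p = (\<Sum>a\<in>A. monom (c a * monomial V a y) (a v))"
  have "coeff p (a0 v) = (\<Sum>a\<in>A'. c a * monomial V a y)"
    unfolding p_def A'_def using insert.prems(1) by (simp add: coeff_sum coeff_monom sum.inter_filter)
  then have "p \<noteq> 0" using y by auto
  then have "finite {t. poly p t = 0}" by (rule poly_roots_finite)
  moreover have "infinite {0<..<\<eta>}" using \<open>\<eta> > 0\<close> by simp
  ultimately have "\<not> {0<..<\<eta>} \<subseteq> {t. poly p t = 0}" using finite_subset by blast
  then obtain t where "t \<in> {0<..<\<eta>}" "poly p t \<noteq> 0" by blast
  then have t: "0 < t" "t < \<eta>" "poly p t \<noteq> 0" by auto
  have "monomial (insert v V) a (y(v := t)) = monomial V a y * t ^ a v" for a
  proof -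
    have "(\<Prod>w\<in>V. (y(v := t)) w ^ a w) = (\<Prod>w\<in>V. y w ^ a w)"
      using insert by (intro prod.cong) auto
    then show ?thesis using insert.hyps by (simp add: monomial_def mult.commute)
  qed
  then have "(\<Sum>a\<in>A. c a * monomial (insert v V) a (y(v := t))) = poly p t"
    by (simp add: p_def poly_sum poly_monom mult.assoc)
  moreover have "\<forall>w\<in>insert v V. \<bar>(y(v := t)) w\<bar> < \<eta>" using y(1) t by auto
  ultimately show ?case using t(3) by (intro exI[of _ "y(v := t)"] conjI) (simp_all only: not_False_eq_True)
qed

text \<open>
  A form of the Bezout bound. For a right-hand side \<open>y\<close> at which the relation between the \<open>f v\<close> and
  \<open>h\<close> does not degenerate, the values of \<open>h\<close> on the solutions of \<open>f v x = y v\<close> are roots of one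
  nonzero polynomial of degree at most \<open>D ^ card V\<close>. Such \<open>y\<close> exist arbitrarily close to the origin.
\<close>

lemma generic_system_few_values:
  assumes V: "finite V" and f: "\<And>v. v \<in> V \<Longrightarrow> polyfun V UNIV D (f v)" and h: "polyfun V UNIV H h"
    and "\<eta> > 0"
  shows "\<exists>y. (\<forall>v\<in>V. \<bar>y v\<bar> < \<eta>) \<and> finite {h x | x. \<forall>v\<in>V. f v x = y v} \<and>
           card {h x | x. \<forall>v\<in>V. f v x = y v} \<le> D ^ card V"
proof -
  define B where "B = D ^ card V"
  have "\<exists>M c. (\<exists>a\<in>exponents V M. \<exists>b\<le>B. c a b \<noteq> 0) \<and>
    (\<forall>x. (\<Sum>b\<le>B. (\<Sum>a\<in>exponents V M. c a b * monomial V a (\<lambda>v. f v x)) * h x ^ b) = 0)"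
    unfolding B_def by (rule polynomial_relation[OF V f h])
  then obtain M c a0 b0 where a0: "a0 \<in> exponents V M" "b0 \<le> B" "c a0 b0 \<noteq> 0"
    and rel: "\<And>x. (\<Sum>b\<le>B. (\<Sum>a\<in>exponents V M. c a b * monomial V a (\<lambda>v. f v x)) * h x ^ b) = 0"
    by (elim exE conjE bexE) auto
  have "\<exists>y. (\<forall>v\<in>V. \<bar>y v\<bar> < \<eta>) \<and> (\<Sum>a\<in>exponents V M. c a b0 * monomial V a y) \<noteq> 0"
  proof (rule nonvanishing_near_zero)
    show "a0 \<in> exponents V M" "c a0 b0 \<noteq> 0" by (rule a0)+
    show "a = b" if "a \<in> exponents V M" "b \<in> exponents V M" "\<And>v. v \<in> V \<Longrightarrow> a v = b v" for a b
      using that by (auto simp: exponents_def fun_eq_iff) metis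
  qed (use card_exponents[OF V] V \<open>\<eta> > 0\<close> in auto)
  then obtain y where y: "\<forall>v\<in>V. \<bar>y v\<bar> < \<eta>" "(\<Sum>a\<in>exponents V M. c a b0 * monomial V a y) \<noteq> 0" by blast
  define p where "p = (\<Sum>b\<le>B. monom (\<Sum>a\<in>exponents V M. c a b * monomial V a y) b)"
  have "coeff p b0 = (\<Sum>a\<in>exponents V M. c a b0 * monomial V a y)"
    unfolding p_def using a0(2) by (simp add: coeff_sum coeff_monom)
  then have p: "p \<noteq> 0" using y by auto
  have deg: "degree p \<le> B"
    unfolding p_def by (intro degree_sum_le) (auto intro: order.trans[OF degree_monom_le])
  have "{h x | x. \<forall>v\<in>V. f v x = y v} \<subseteq> {t. poly p t = 0}"
  proof safe
    fix x assume x: "\<forall>v\<in>V. f v x = y v"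
    have "monomial V a (\<lambda>v. f v x) = monomial V a y" for a
      using x unfolding monomial_def by (intro prod.cong) auto
    then show "poly p (h x) = 0" using rel[of x] by (simp add: p_def poly_sum poly_monom)
  qed
  moreover have "finite {t. poly p t = 0}" "card {t. poly p t = 0} \<le> B"
    using p deg poly_roots_finite card_poly_roots_bound[OF p] by auto
  ultimately show ?thesis using y(1) unfolding B_def
    by (meson card_mono finite_subset le_trans)
qed

section \<open>Counting the critical values of a polynomial\<close>

lemma compact_pi_box:
  "compact {x :: 'v \<Rightarrow> real. (\<forall>v\<in>V. \<bar>x v\<bar> \<le> R) \<and> (\<forall>v. v \<notin> V \<longrightarrow> x v = 0)}"
proof -
  define S where "S = (\<lambda>v. if v \<in> V then {-R..R} else {0 :: real})"
  have "compactin (product_topology (\<lambda>_ :: 'v. euclidean) UNIV) (PiE UNIV S)"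
    unfolding compactin_PiE by (auto simp: S_def)
  then have "compact (PiE UNIV S)"
    by (simp add: euclidean_product_topology)
  moreover have "PiE UNIV S = {x. (\<forall>v\<in>V. \<bar>x v\<bar> \<le> R) \<and> (\<forall>v. v \<notin> V \<longrightarrow> x v = 0)}"
    by (auto simp: S_def PiE_def Pi_def abs_le_iff split: if_splits; force)
  ultimately show ?thesis by simp
qed

lemma compact_positive_lower_bound:
  fixes P :: "'a::topological_space \<Rightarrow> real"
  assumes "compact S" "continuous_on S P" "\<And>x. x \<in> S \<Longrightarrow> P x > 0"
  shows "\<exists>\<delta>>0. \<forall>x\<in>S. P x \<ge> \<delta>"
proof (cases "S = {}")
  case True
  then show ?thesis by (intro exI[of _ 1]) auto
next
  case False
  from continuous_attains_inf[OF assms(1) this assms(2)] show ?thesis using assms(3) by blast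
qed

text \<open>
  Since \<open>K\<close> is countable, there are levels outside \<open>K\<close> as close as desired to each point of \<open>T\<close>, on
  both sides of it.
\<close>

lemma separating_levels:
  fixes K :: "real set"
  assumes "finite T" "countable K"
  shows "\<exists>l u r. (\<forall>t\<in>T. l t < t \<and> t < u t \<and> l t \<notin> K \<and> u t \<notin> K \<and> t - r t \<le> l t \<and> u t \<le> t + r t) \<and>
           (\<forall>s\<in>T. \<forall>t\<in>T. s \<noteq> t \<longrightarrow> r s + r t < \<bar>s - t\<bar>)"
proof -
  have "\<exists>x. a < x \<and> x < b \<and> x \<notin> K" if "a < b" for a b
  proof -
    have "\<not> {a<..<b} \<subseteq> K"
      using uncountable_open_interval[of a b] countable_subset[OF _ assms(2)] that by blast
    then show ?thesis by auto
  qed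
  note dense = this
  have "\<forall>t. \<exists>d>0. \<forall>s\<in>T. s \<noteq> t \<longrightarrow> d \<le> dist t s"
    using finite_set_avoid[OF assms(1)] by blast
  then obtain d where d: "\<And>t. d t > 0" "\<And>s t. s \<in> T \<Longrightarrow> s \<noteq> t \<Longrightarrow> d t \<le> dist t s" by metis
  define r where "r = (\<lambda>t. d t / 3)"
  have "\<forall>t. \<exists>l. t - r t < l \<and> l < t \<and> l \<notin> K" "\<forall>t. \<exists>u. t < u \<and> u < t + r t \<and> u \<notin> K"
    using d(1) by (auto simp: r_def intro!: dense)
  then obtain l u where "\<And>t. t - r t < l t \<and> l t < t \<and> l t \<notin> K" "\<And>t. t < u t \<and> u t < t + r t \<and> u t \<notin> K"
    by metis
  moreover have "r s + r t < \<bar>s - t\<bar>" if "s \<in> T" "t \<in> T" "s \<noteq> t" for s t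
    using d(2)[of s t] d(2)[of t s] that d(1)[of t] by (simp add: r_def dist_real_def)
  ultimately show ?thesis by (intro exI[of _ l] exI[of _ u] exI[of _ r]) (auto intro: less_imp_le)
qed

text \<open>
  A small change of the coordinate \<open>v\<close> leaves \<open>x\<close> in the box and in the slab \<open>l \<le> F \<le> u\<close>, so
  the restriction of \<open>Q\<close> to a coordinate line has a local minimum at \<open>x\<close>.
\<close>

lemma slab_minimum_critical:
  assumes v: "has_partial v Q Q'" "has_partial v F F'" "v \<in> V"
    and x: "\<forall>w\<in>V. \<bar>x w\<bar> < R" "\<forall>w. w \<notin> V \<longrightarrow> x w = 0" "l < F x" "F x < u"
    and min: "\<And>x'. \<lbrakk>\<forall>w\<in>V. \<bar>x' w\<bar> \<le> R; \<forall>w. w \<notin> V \<longrightarrow> x' w = 0; l \<le> F x'; F x' \<le> u\<rbrakk> \<Longrightarrow> Q x \<le> Q x'"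
  shows "Q' x = 0"
proof -
  have dQ: "((\<lambda>t. Q (x(v := t))) has_real_derivative Q' x) (at (x v))"
    and dF: "((\<lambda>t. F (x(v := t))) has_real_derivative F' x) (at (x v))"
    using v unfolding has_partial_def by blast+
  have "isCont (\<lambda>t. F (x(v := t))) (x v)" using dF by (rule DERIV_isCont)
  then have "((\<lambda>t. F (x(v := t))) \<longlongrightarrow> F (x(v := x v))) (nhds (x v))"
    unfolding isCont_def by (subst (asm) tendsto_at_iff_tendsto_nhds)
  then have tF: "((\<lambda>t. F (x(v := t))) \<longlongrightarrow> F x) (nhds (x v))" by simp
  have tx: "((\<lambda>t. t) \<longlongrightarrow> x v) (nhds (x v))" by (rule filterlim_ident)
  have "-R < x v" "x v < R" using x(1) v(3) by (auto simp: abs_less_iff)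
  then have "\<forall>\<^sub>F t in nhds (x v). l < F (x(v := t)) \<and> F (x(v := t)) < u \<and> -R < t \<and> t < R"
    by (intro eventually_conj order_tendstoD[OF tF] order_tendstoD[OF tx] x)
  then obtain e where e: "e > 0" "\<And>t. dist t (x v) < e \<Longrightarrow>
      l < F (x(v := t)) \<and> F (x(v := t)) < u \<and> -R < t \<and> t < R"
    unfolding eventually_nhds_metric by blast
  have "Q (x(v := x v)) \<le> Q (x(v := t))" if "\<bar>x v - t\<bar> < e" for t
  proof -
    have t: "l < F (x(v := t)) \<and> F (x(v := t)) < u \<and> -R < t \<and> t < R"
      using e(2)[of t] that by (simp add: dist_real_def abs_minus_commute)
    have "Q x \<le> Q (x(v := t))"
      using t x v(3) by (intro min) (auto simp: less_imp_le)
    then show ?thesis by simp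
  qed
  with dQ e(1) show ?thesis by (intro DERIV_local_min[of _ _ "x v" e]) auto
qed

text \<open>
  The sum \<open>P\<close> of the squares of the partial derivatives of \<open>F\<close> has the critical points of \<open>F\<close> as its
  zeros. Given finitely many critical values \<open>t\<close>, each of them is enclosed in an interval
  \<open>[l t, u t]\<close> whose ends are not critical values; this is possible as there are only countably many
  critical values. Perturb \<open>P\<close> to \<open>Q x = P x + \<epsilon> |x|\<^sup>2 - y \<bullet> x\<close>. On the slab
  \<open>l t \<le> F \<le> u t\<close>, within a large box, \<open>Q\<close> is small at a critical point with value \<open>t\<close>; it is larger
  on the faces of the box because of \<open>\<epsilon> |x|\<^sup>2\<close>, and on the two level sets because \<open>P\<close> has a positive
  lower bound there. So its minimum is a solution of the system \<open>\<partial>P + 2 \<epsilon> x = y\<close>, whose equations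
  have degree at most \<open>2 d - 1\<close>. The solutions found for distinct \<open>t\<close> have distinct values of \<open>F\<close>, and
  for suitable small \<open>y\<close> there are at most \<open>(2 d - 1) ^ card V\<close> such values.
\<close>

lemma critical_values_bound:
  assumes V: "finite V" and d: "d \<ge> 1" and F: "polyfun V UNIV (Suc d) F"
    and F': "\<And>v. v \<in> V \<Longrightarrow> has_partial v F (F' v)"
  shows "finite {F z | z. \<forall>v\<in>V. F' v z = 0} \<and>
         card {F z | z. \<forall>v\<in>V. F' v z = 0} \<le> (2 * d - 1) ^ card V"
proof -
  define K where "K = {F z | z. \<forall>v\<in>V. F' v z = 0}"
  define N where "N = real (card V)"
  define P where "P = (\<lambda>x. \<Sum>v\<in>V. F' v x ^ 2)"
  define box where "box R = {x. (\<forall>v\<in>V. \<bar>x v\<bar> \<le> R) \<and> (\<forall>v. v \<notin> V \<longrightarrow> x v = 0)}" for R :: real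
  have K: "countable K" unfolding K_def by (rule countable_critical_values[OF V F F'])
  have Pnn: "P x \<ge> 0" for x unfolding P_def by (intro sum_nonneg) auto
  have P0: "P x = 0 \<longleftrightarrow> (\<forall>v\<in>V. F' v x = 0)" for x
    unfolding P_def using V by (subst sum_nonneg_eq_0_iff) auto
  have F'poly: "polyfun V UNIV d (F' v)" if "v \<in> V" for v
    using polyfun_partial[OF F F'[OF that]] .
  have Ppoly: "polyfun V UNIV (2 * d) P"
    unfolding P_def by (intro polyfun_sum polyfun_power F'poly)
  have "\<exists>P'. has_partial v P P' \<and> polyfun V UNIV (2 * d - 1) P'" for v
    using polyfun_has_partial[OF Ppoly, of v] by (elim exE conjE) (intro exI conjI)
  then obtain P' where P': "\<And>v. has_partial v P (P' v)" "\<And>v. polyfun V UNIV (2 * d - 1) (P' v)" by metis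
  have cP: "continuous_on S P" and cF: "continuous_on S F" for S
    by (rule continuous_on_subset[OF polyfun_continuous[OF Ppoly] subset_UNIV],
        rule continuous_on_subset[OF polyfun_continuous[OF F] subset_UNIV])
  have main: "card T \<le> (2 * d - 1) ^ card V" if T: "T \<subseteq> K" "finite T" for T
  proof -
    have "\<forall>t\<in>T. \<exists>z. F z = t \<and> P z = 0 \<and> (\<forall>v. v \<notin> V \<longrightarrow> z v = 0)"
    proof
      fix t assume "t \<in> T"
      then obtain z where z: "F z = t" "\<forall>v\<in>V. F' v z = 0" using T unfolding K_def by blast
      define z' where "z' = (\<lambda>v. if v \<in> V then z v else 0)"
      have "F z' = F z" "P z' = P z"
        by (rule polyfun_cong_vars[OF F] polyfun_cong_vars[OF Ppoly]; simp add: z'_def)+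
      then show "\<exists>z. F z = t \<and> P z = 0 \<and> (\<forall>v. v \<notin> V \<longrightarrow> z v = 0)"
        using z P0 by (intro exI[of _ z']) (auto simp: z'_def)
    qed
    then obtain z where z: "\<And>t. t \<in> T \<Longrightarrow> F (z t) = t" "\<And>t. t \<in> T \<Longrightarrow> P (z t) = 0"
        "\<And>t v. t \<in> T \<Longrightarrow> v \<notin> V \<Longrightarrow> z t v = 0" by metis
    obtain l u r where lu: "\<And>t. t \<in> T \<Longrightarrow> l t < t \<and> t < u t \<and> l t \<notin> K \<and> u t \<notin> K \<and> t - r t \<le> l t \<and> u t \<le> t + r t"
      and r: "\<And>s t. s \<in> T \<Longrightarrow> t \<in> T \<Longrightarrow> s \<noteq> t \<Longrightarrow> r s + r t < \<bar>s - t\<bar>"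
      using separating_levels[OF T(2) K] by metis
    \<comment> \<open>Every \<open>z t\<close> satisfies \<open>|z t|\<^sup>2 \<le> \<rho>\<close>, while \<open>|x|\<^sup>2 \<ge> \<rho> + 1\<close> on the faces of the box of size \<open>R\<close>.\<close>
    define \<rho> where "\<rho> = (\<Sum>t\<in>T. \<Sum>v\<in>V. (z t v)\<^sup>2)"
    define R where "R = \<rho> + 1"
    have \<rho>: "\<rho> \<ge> 0" unfolding \<rho>_def by (intro sum_nonneg) auto
    have R: "R \<ge> 1" "R\<^sup>2 \<ge> \<rho> + 1"
      using \<rho> by (auto simp: R_def power2_eq_square algebra_simps)
    have z\<rho>: "(\<Sum>v\<in>V. (z t v)\<^sup>2) \<le> \<rho>" if "t \<in> T" for t
      unfolding \<rho>_def using T(2) that by (intro member_le_sum sum_nonneg) auto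
    have zR: "\<bar>z t v\<bar> \<le> R" if "t \<in> T" "v \<in> V" for t v
    proof -
      have "(z t v)\<^sup>2 \<le> (\<Sum>v\<in>V. (z t v)\<^sup>2)" using V that by (intro member_le_sum) auto
      also have "\<dots> \<le> R\<^sup>2" using z\<rho>[OF that(1)] R by simp
      finally show ?thesis using R by (simp add: abs_le_square_iff[symmetric])
    qed
    \<comment> \<open>The ends of the slabs within the box: no critical value is attained here, so \<open>P\<close> is bounded away from zero.\<close>
    define Ed where "Ed = box R \<inter> F -` (l ` T \<union> u ` T)"
    have "compact Ed"
      unfolding Ed_def box_def
      by (intro compact_Int_closed compact_pi_box closed_vimage finite_imp_closed cF) (use T in auto)
    moreover have "P x > 0" if "x \<in> Ed" for x
    proof -
      have "F x \<notin> K" using that lu by (auto simp: Ed_def)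
      then have "P x \<noteq> 0" unfolding P0 K_def by blast
      then show ?thesis using Pnn[of x] by simp
    qed
    ultimately obtain \<delta> where \<delta>: "\<delta> > 0" "\<And>x. x \<in> Ed \<Longrightarrow> P x \<ge> \<delta>"
      using compact_positive_lower_bound[OF _ cP, of Ed] by blast
    \<comment> \<open>At \<open>z t\<close> the term \<open>\<epsilon> |x|\<^sup>2\<close> must stay below \<open>\<delta> / 2\<close>, and \<open>\<eta>\<close> must keep the linear term below
      the gap \<open>\<epsilon>\<close> at the faces and the gap \<open>\<delta> / 2\<close> at the ends of the slabs.\<close>
    define \<epsilon> where "\<epsilon> = \<delta> / (2 * (\<rho> + 1))"
    have \<epsilon>: "\<epsilon> > 0" "\<epsilon> * \<rho> < \<delta> / 2"
      using \<delta> \<rho> by (auto simp: \<epsilon>_def field_simps)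
    define \<eta> where "\<eta> = min \<epsilon> (\<delta> / 2) / (2 * (N * R) + 1)"
    have NR: "N * R \<ge> 0" using R by (simp add: N_def)
    have \<eta>: "\<eta> > 0" "2 * (N * \<eta> * R) < min \<epsilon> (\<delta> / 2)"
    proof -
      show "\<eta> > 0" using NR \<epsilon> \<delta> by (auto simp: \<eta>_def)
      then have "2 * (N * \<eta> * R) < (2 * (N * R) + 1) * \<eta>" by (simp add: algebra_simps)
      also have "\<dots> = min \<epsilon> (\<delta> / 2)" using NR by (simp add: \<eta>_def)
      finally show "2 * (N * \<eta> * R) < min \<epsilon> (\<delta> / 2)" .
    qed
    define f where "f = (\<lambda>v x. P' v x + 2 * \<epsilon> * x v)"
    have f: "polyfun V UNIV (2 * d - 1) (f v)" if "v \<in> V" for v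
      unfolding f_def using d that P'(2)
      by (intro polyfun.add polyfun_cmult P'(2)) (auto intro: polyfun.weaken[OF polyfun.var])
    have "\<exists>y. (\<forall>v\<in>V. \<bar>y v\<bar> < \<eta>) \<and> finite {F x | x. \<forall>v\<in>V. f v x = y v} \<and>
        card {F x | x. \<forall>v\<in>V. f v x = y v} \<le> (2 * d - 1) ^ card V"
      by (rule generic_system_few_values[OF V f F \<eta>(1)])
    then obtain y where y: "\<And>v. v \<in> V \<Longrightarrow> \<bar>y v\<bar> < \<eta>"
      and few: "finite {F x | x. \<forall>v\<in>V. f v x = y v}"
        "card {F x | x. \<forall>v\<in>V. f v x = y v} \<le> (2 * d - 1) ^ card V"
      by (elim exE conjE) auto
    define Q where "Q = (\<lambda>x. P x + (\<epsilon> * (\<Sum>v\<in>V. (x v)\<^sup>2) - (\<Sum>v\<in>V. y v * x v)))"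
    have Q': "has_partial v Q (\<lambda>x. f v x - y v)" if "v \<in> V" for v
    proof -
      have sq: "has_partial v (\<lambda>x. (x w)\<^sup>2) (\<lambda>x. if w = v then 2 * x v else 0)" for w
        using has_partial_intros(6)[OF has_partial_intros(2) has_partial_intros(2), of v]
          has_partial_intros(6)[OF has_partial_intros(3) has_partial_intros(3), of v w w]
        by (cases "w = v") (auto simp: power2_eq_square)
      have li: "has_partial v (\<lambda>x. y w * x w) (\<lambda>x. if w = v then y v else 0)" for w
        using has_partial_intros(6)[OF has_partial_intros(1) has_partial_intros(2), of v "y v"]
          has_partial_intros(6)[OF has_partial_intros(1) has_partial_intros(3), of v w "y w"]
        by (cases "w = v") auto
      have "has_partial v Q (\<lambda>x. P' v x + ((\<epsilon> * (\<Sum>w\<in>V. if w = v then 2 * x v else 0) + 0 * (\<Sum>w\<in>V. (x w)\<^sup>2))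
          - (\<Sum>w\<in>V. if w = v then y v else 0)))"
        unfolding Q_def
        by (intro has_partial_intros(1,4,5,6) has_partial_sum sq li P'(1))
      then show ?thesis
        using V that by (simp add: f_def algebra_simps)
    qed
    have cQ: "continuous_on S Q" for S
      unfolding Q_def
      by (intro continuous_intros cP continuous_on_subset[OF continuous_on_product_coordinates]) auto
    have lin: "\<bar>\<Sum>v\<in>V. y v * x v\<bar> \<le> N * \<eta> * R" if "x \<in> box R" for x
    proof -
      have "\<bar>\<Sum>v\<in>V. y v * x v\<bar> \<le> (\<Sum>v\<in>V. \<bar>y v * x v\<bar>)" by (rule sum_abs)
      also have "\<dots> \<le> (\<Sum>v\<in>V. \<eta> * R)"
        using y that \<eta>(1) by (intro sum_mono) (auto simp: box_def abs_mult less_imp_le intro!: mult_mono)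
      finally show ?thesis by (simp add: N_def)
    qed
    have "\<exists>x. F x \<in> {l t..u t} \<and> (\<forall>v\<in>V. f v x = y v)" if t: "t \<in> T" for t
    proof -
      define C where "C = box R \<inter> {x. l t \<le> F x \<and> F x \<le> u t}"
      have "closed {x. l t \<le> F x \<and> F x \<le> u t}"
        by (intro closed_Collect_conj closed_Collect_le cF continuous_on_const)
      then have "compact C" unfolding C_def box_def by (intro compact_Int_closed compact_pi_box)
      moreover have zC: "z t \<in> C"
        using t z zR lu[OF t] by (auto simp: C_def box_def less_imp_le)
      ultimately obtain x where x: "x \<in> C" "\<And>x'. x' \<in> C \<Longrightarrow> Q x \<le> Q x'"
        using continuous_attains_inf[OF _ _ cQ, of C] by blast
      have xb: "x \<in> box R" using x by (simp add: C_def)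
      have Qz: "Q (z t) \<le> \<epsilon> * \<rho> + N * \<eta> * R"
      proof -
        have "\<epsilon> * (\<Sum>v\<in>V. (z t v)\<^sup>2) \<le> \<epsilon> * \<rho>" using z\<rho>[OF t] \<epsilon> by simp
        moreover have "z t \<in> box R" using zC by (simp add: C_def)
        ultimately show ?thesis using lin[of "z t"] z(2)[OF t] by (simp add: Q_def abs_le_iff)
      qed
      have Qx: "Q x \<ge> P x + \<epsilon> * (\<Sum>v\<in>V. (x v)\<^sup>2) - N * \<eta> * R"
        using lin[OF xb] by (simp add: Q_def abs_le_iff)
      have sqnn: "\<epsilon> * (\<Sum>v\<in>V. (x v)\<^sup>2) \<ge> 0" using \<epsilon> by (intro mult_nonneg_nonneg sum_nonneg) auto
      have inside: "\<bar>x v\<bar> < R" if "v \<in> V" for v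
      proof (rule ccontr)
        assume "\<not> \<bar>x v\<bar> < R"
        then have "R\<^sup>2 \<le> (x v)\<^sup>2" using R by (simp add: abs_le_square_iff[symmetric])
        also have "\<dots> \<le> (\<Sum>v\<in>V. (x v)\<^sup>2)" using V that by (intro member_le_sum) auto
        finally have "\<epsilon> * (\<rho> + 1) \<le> \<epsilon> * (\<Sum>v\<in>V. (x v)\<^sup>2)" using R \<epsilon> by simp
        then show False
          using Qx Qz x(2)[OF zC] Pnn[of x] \<eta>(2) by (simp add: algebra_simps)
      qed
      have "x \<notin> Ed"
      proof
        assume "x \<in> Ed"
        then have "P x \<ge> \<delta>" by (rule \<delta>)
        then show False using Qx Qz x(2)[OF zC] sqnn \<eta>(2) \<epsilon>(2) by simp
      qed
      then have "F x \<noteq> l t" "F x \<noteq> u t" using xb t unfolding Ed_def by blast+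
      then have lF: "l t < F x" "F x < u t" using x(1) by (auto simp: C_def)
      have "f v x - y v = 0" if "v \<in> V" for v
        using xb x(2)
        by (intro slab_minimum_critical[OF Q'[OF that] F'[OF that] that, where x = x and R = R and l = "l t" and u = "u t"])
           (auto simp: inside lF C_def box_def)
      then show ?thesis using lF by (intro exI[of _ x]) auto
    qed
    then obtain x where x: "\<And>t. t \<in> T \<Longrightarrow> F (x t) \<in> {l t..u t}" "\<And>t v. t \<in> T \<Longrightarrow> v \<in> V \<Longrightarrow> f v (x t) = y v"
      by metis
    have "inj_on (\<lambda>t. F (x t)) T"
    proof (rule inj_onI, rule ccontr)
      fix s t assume st: "s \<in> T" "t \<in> T" "F (x s) = F (x t)" "s \<noteq> t"
      then show False using r[of s t] lu[of s] lu[of t] x(1)[of s] x(1)[of t] by auto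
    qed
    moreover have "(\<lambda>t. F (x t)) ` T \<subseteq> {F x | x. \<forall>v\<in>V. f v x = y v}" using x(2) by blast
    ultimately have "card T \<le> card {F x | x. \<forall>v\<in>V. f v x = y v}"
      using few(1) by (rule card_inj_on_le)
    then show ?thesis using few(2) by simp
  qed
  then show ?thesis unfolding K_def[symmetric] by (intro finite_if_finite_subsets_card_bdd) auto
qed

section \<open>Lagrange multipliers at singular perturbations\<close>

text \<open>
  If \<open>0\<close> is not in the convex hull of the vectors \<open>A i\<close>, then a hyperplane separates it from the hull,
  and the negative of its normal is a common direction of descent.
\<close>

lemma gordan:
  fixes A :: "'i \<Rightarrow> 'a::euclidean_space"
  assumes K: "finite K" and no: "\<nexists>y. \<forall>i\<in>K. y \<bullet> A i < 0"
  shows "\<exists>u. (\<forall>i\<in>K. u i \<ge> 0) \<and> sum u K = 1 \<and> (\<Sum>i\<in>K. u i *\<^sub>R A i) = 0"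
proof -
  have fin: "finite (A ` K)" using K by simp
  have "0 \<in> convex hull (A ` K)"
  proof (rule ccontr)
    assume "0 \<notin> convex hull (A ` K)"
    moreover have "closed (convex hull (A ` K))"
      by (intro compact_imp_closed compact_convex_hull finite_imp_compact fin)
    ultimately obtain a b where "b > 0" "\<And>x. x \<in> convex hull (A ` K) \<Longrightarrow> a \<bullet> x > b"
      using separating_hyperplane_closed_0[OF convex_convex_hull] by blast
    then have "\<forall>i\<in>K. (-a) \<bullet> A i < 0"
      using hull_inc[of _ "A ` K" convex] by fastforce
    then show False using no by blast
  qed
  then obtain w where w: "\<forall>x\<in>A ` K. 0 \<le> w x" "sum w (A ` K) = 1" "(\<Sum>x\<in>A ` K. w x *\<^sub>R x) = 0"
    unfolding convex_hull_finite[OF fin] by blast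
  \<comment> \<open>The hull gives weights on vectors; one index is chosen for each vector to carry its weight.\<close>
  obtain K0 where K0: "K0 \<subseteq> K" "inj_on A K0" "A ` K = A ` K0"
    using subset_image_inj[of "A ` K" A K] by blast
  define u where "u i = (if i \<in> K0 then w (A i) else 0)" for i
  have "sum u K = sum u K0" "(\<Sum>i\<in>K. u i *\<^sub>R A i) = (\<Sum>i\<in>K0. u i *\<^sub>R A i)"
    using K K0(1) by (intro sum.mono_neutral_right; auto simp: u_def)+
  moreover have "sum u K0 = 1" "(\<Sum>i\<in>K0. u i *\<^sub>R A i) = 0"
    using w(2,3) unfolding K0(3) sum.reindex[OF K0(2)] by (simp_all add: u_def)
  ultimately show ?thesis
    using w(1) by (intro exI[of _ u]) (auto simp: u_def)
qed

section \<open>Singular perturbations as critical values\<close>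

text \<open>In a point of the larger space, \<open>Inl j\<close> indexes the coordinates of \<open>x\<close> and \<open>Inr i\<close> the multipliers.\<close>

definition point_of :: "('n::finite + nat \<Rightarrow> real) \<Rightarrow> real ^ 'n" where
  "point_of z = (\<chi> j. z (Inl j))"

lemma polyfun_point_of:
  fixes f :: "real ^ 'n \<Rightarrow> real"
  assumes "poly_function_deg_le d f" "range Inl \<subseteq> V"
  shows "polyfun V UNIV d (\<lambda>z. f (point_of z))"
proof -
  from assms(1) obtain c :: "nat ^ 'n \<Rightarrow> real" where
    c: "\<And>x. f x = (\<Sum>e | (\<Sum>i\<in>UNIV. e $ i) \<le> d. c e * (\<Prod>i\<in>UNIV. (x $ i) ^ (e $ i)))"
    unfolding poly_function_deg_le_def by blast
  have "polyfun V UNIV d (\<lambda>z. \<Prod>i\<in>UNIV. (z (Inl i)) ^ (e $ i))"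
    if "(\<Sum>i\<in>UNIV. e $ i) \<le> d" for e :: "nat ^ 'n"
  proof -
    have "polyfun V UNIV (\<Sum>i\<in>UNIV. (e $ i) * 1) (\<lambda>z. \<Prod>i\<in>UNIV. (z (Inl i)) ^ (e $ i))"
      using assms(2) by (intro polyfun_prod polyfun_power polyfun.var) auto
    then show ?thesis by (rule polyfun.weaken) (use that in simp)
  qed
  then show ?thesis
    unfolding c point_of_def by (auto intro!: polyfun_sum polyfun_cmult)
qed

lemma has_partial_point_of:
  fixes f :: "real ^ 'n \<Rightarrow> real"
  assumes "poly_function_deg_le d f"
  shows "has_partial (Inl j) (\<lambda>z. f (point_of z)) (\<lambda>z. gradient f (point_of z) $ j)"
  unfolding has_partial_def
proof
  fix z :: "'n + nat \<Rightarrow> real"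
  have "f differentiable (at (point_of z))"
    using differentiable_at_real_polynomial_function
      poly_function_deg_le_imp_real_polynomial_function[OF assms] by blast
  then have "GDERIV f (point_of z) :> gradient f (point_of z)" by (rule GDERIV_gradient)
  then have f: "(f has_derivative (\<lambda>h. h \<bullet> gradient f (point_of z)))
      (at (point_of (z(Inl j := z (Inl j)))))"
    by (simp add: gderiv_def)
  have "point_of (z(Inl j := t)) = point_of z + (t - z (Inl j)) *\<^sub>R axis j 1" for t
    by (simp add: point_of_def vec_eq_iff axis_def)
  then have p: "((\<lambda>t. point_of (z(Inl j := t))) has_derivative (\<lambda>h. h *\<^sub>R axis j 1)) (at (z (Inl j)))"
    by (auto intro!: derivative_eq_intros)
  have "((\<lambda>t. f (point_of (z(Inl j := t)))) has_derivative
      (\<lambda>h. (h *\<^sub>R axis j 1) \<bullet> gradient f (point_of z))) (at (z (Inl j)))"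
    by (rule has_derivative_compose[OF p f])
  then show "((\<lambda>t. f (point_of (z(Inl j := t)))) has_real_derivative gradient f (point_of z) $ j)
      (at (z (Inl j)))"
    by (simp add: has_field_derivative_def inner_axis' mult_commute_abs)
qed

lemma has_partial_point_of_multiplier:
  "has_partial (Inr i) (\<lambda>z. f (point_of z)) (\<lambda>z. 0)"
  by (simp add: has_partial_def point_of_def)

lemma sum_power_card_Pow:
  fixes a :: nat
  assumes "finite S"
  shows "(\<Sum>K\<in>Pow S. a ^ card K) = (a + 1) ^ card S"
  using assms
proof induction
  case empty
  then show ?case by simp
next
  case (insert s S)
  have "(\<Sum>K\<in>insert s ` Pow S. a ^ card K) = (\<Sum>K\<in>Pow S. a ^ card (insert s K))"
    using insert.hyps by (intro sum.reindex_cong[of "insert s"]) (auto simp: inj_on_def)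
  also have "\<dots> = (\<Sum>K\<in>Pow S. a * a ^ card K)"
  proof (intro sum.cong refl)
    fix K assume "K \<in> Pow S"
    then have "finite K" "s \<notin> K" using insert.hyps finite_subset by auto
    then show "a ^ card (insert s K) = a * a ^ card K" by simp
  qed
  finally have "(\<Sum>K\<in>insert s ` Pow S. a ^ card K) = a * (a + 1) ^ card S"
    using insert.IH by (simp add: sum_distrib_left[symmetric])
  moreover have "Pow S \<inter> insert s ` Pow S = {}" using insert.hyps by auto
  ultimately show ?case
    using insert by (simp add: Pow_insert sum.union_disjoint algebra_simps)
qed

text \<open>
  The Lagrange function \<open>\<alpha> + (\<Sum>i\<in>K. u i * (g i x - \<alpha> * of_bool (i \<in> I)))\<close> after elimination of \<open>\<alpha>\<close>
  by \<open>\<alpha> = g k x\<close>, where \<open>k \<in> K \<inter> I\<close>; this removes the multiplier \<open>u k\<close> as well, which the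
  normalization of the multipliers over \<open>K \<inter> I\<close> determines from the others.
\<close>

definition lagrangian ::
    "(nat \<Rightarrow> real ^ 'n \<Rightarrow> real) \<Rightarrow> nat set \<Rightarrow> nat set \<Rightarrow> nat \<Rightarrow> ('n + nat \<Rightarrow> real) \<Rightarrow> real" where
  "lagrangian g I K k z = g k (point_of z) +
     (\<Sum>i\<in>K - {k}. z (Inr i) * (g i (point_of z) - of_bool (i \<in> I) * g k (point_of z)))"

definition lagrangian_partial ::
    "(nat \<Rightarrow> real ^ 'n \<Rightarrow> real) \<Rightarrow> nat set \<Rightarrow> nat set \<Rightarrow> nat \<Rightarrow> 'n + nat \<Rightarrow> ('n + nat \<Rightarrow> real) \<Rightarrow> real" where
  "lagrangian_partial g I K k v z = (case v of
     Inl j \<Rightarrow> gradient (g k) (point_of z) $ j + (\<Sum>i\<in>K - {k}. z (Inr i) *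
         (gradient (g i) (point_of z) $ j - of_bool (i \<in> I) * gradient (g k) (point_of z) $ j))
   | Inr i \<Rightarrow> g i (point_of z) - of_bool (i \<in> I) * g k (point_of z))"

text \<open>
  The Lagrange function has degree \<open>d + 1\<close> in \<open>CARD('n) + card K - 1\<close> variables: the coordinates of
  the point and the multipliers other than that of \<open>k\<close>.
\<close>

lemma lagrangian_critical_values:
  fixes g :: "nat \<Rightarrow> real ^ 'n \<Rightarrow> real" and I :: "nat set"
  assumes d: "d \<ge> 1" and K: "finite K" "k \<in> K"
    and g: "\<And>i. i \<in> K \<Longrightarrow> poly_function_deg_le d (g i)"
  defines "V \<equiv> range Inl \<union> Inr ` (K - {k})"
  defines "CV \<equiv> {lagrangian g I K k z | z. \<forall>v\<in>V. lagrangian_partial g I K k v z = 0}"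
  shows "finite CV \<and> card CV \<le> (2 * d - 1) ^ (CARD('n) + card K)"
proof -
  have V: "finite V" using K by (simp add: V_def)
  have "card V = card (range Inl :: ('n + nat) set) + card (Inr ` (K - {k}) :: ('n + nat) set)"
    unfolding V_def using K by (intro card_Un_disjoint) auto
  also have "\<dots> \<le> CARD('n) + card K"
    using K by (simp add: card_image)
  finally have cV: "card V \<le> CARD('n) + card K" .
  have P: "polyfun V UNIV d (\<lambda>z. g i (point_of z))" if "i \<in> K" for i
    using polyfun_point_of[OF g[OF that], of V] by (simp add: V_def)
  have "polyfun V UNIV (1 + d) (\<lambda>z. z (Inr i) * (g i (point_of z) - of_bool (i \<in> I) * g k (point_of z)))"
    if "i \<in> K - {k}" for i
    using that K by (intro polyfun.mult polyfun.var polyfun_diff polyfun_cmult P) (auto simp: V_def)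
  then have pl: "polyfun V UNIV (Suc d) (lagrangian g I K k)"
    unfolding lagrangian_def[abs_def]
    by (intro polyfun.add polyfun_sum polyfun.weaken[OF P[OF K(2)]]) auto
  have "has_partial v (lagrangian g I K k) (lagrangian_partial g I K k v)" if v: "v \<in> V" for v
  proof (cases v)
    case (Inl j)
    have h: "has_partial v (\<lambda>z. g i (point_of z)) (\<lambda>z. gradient (g i) (point_of z) $ j)" if "i \<in> K" for i
      unfolding Inl by (rule has_partial_point_of[OF g[OF that]])
    have "has_partial v (lagrangian g I K k) (\<lambda>z. gradient (g k) (point_of z) $ j +
        (\<Sum>i\<in>K - {k}. z (Inr i) * (gradient (g i) (point_of z) $ j -
            (of_bool (i \<in> I) * gradient (g k) (point_of z) $ j + 0 * g k (point_of z)))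
          + 0 * (g i (point_of z) - of_bool (i \<in> I) * g k (point_of z))))"
      unfolding lagrangian_def[abs_def] using K Inl
      by (intro has_partial_intros has_partial_sum h) auto
    then show ?thesis by (simp add: Inl lagrangian_partial_def[abs_def])
  next
    case (Inr l)
    then have l: "l \<in> K - {k}" using v by (auto simp: V_def)
    have h: "has_partial v (\<lambda>z. g i (point_of z)) (\<lambda>z. 0)" for i
      unfolding Inr by (rule has_partial_point_of_multiplier)
    have h': "has_partial v (\<lambda>z. z (Inr i)) (\<lambda>z. if i = l then 1 else 0)" for i
      unfolding Inr by (cases "i = l") (auto intro: has_partial_intros)
    have "has_partial v (lagrangian g I K k) (\<lambda>z. 0 +
        (\<Sum>i\<in>K - {k}. z (Inr i) * (0 - (of_bool (i \<in> I) * 0 + 0 * g k (point_of z)))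
          + (if i = l then 1 else 0) * (g i (point_of z) - of_bool (i \<in> I) * g k (point_of z))))"
      unfolding lagrangian_def[abs_def]
      by (intro has_partial_intros(1,4,5,6) has_partial_sum h h')
    moreover have "(\<Sum>i\<in>K - {k}. (if i = l then 1 else 0) * (g i x - of_bool (i \<in> I) * g k x)) =
        g l x - of_bool (l \<in> I) * g k x" for x
      using l K by (simp add: if_distrib[of "\<lambda>c. c * _"] cong: if_cong)
    ultimately show ?thesis by (simp add: Inr lagrangian_partial_def[abs_def])
  qed
  then have "finite CV \<and> card CV \<le> (2 * d - 1) ^ card V"
    unfolding CV_def by (intro critical_values_bound V d pl)
  moreover have "(2 * d - 1) ^ card V \<le> (2 * d - 1) ^ (CARD('n) + card K)"
    using cV d by (intro power_increasing) auto
  ultimately show ?thesis by linarith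
qed

text \<open>
  Failure of the constraint qualification gives nonnegative multipliers on the active constraints \<open>K\<close>
  under which the gradients cancel. They cannot all vanish on \<open>I\<close>: otherwise the gradients of the
  active constraints in \<open>J\<close> alone would cancel, against the qualification assumed for \<open>J\<close>. Hence
  they can be scaled to have sum \<open>1\<close> over \<open>K \<inter> I\<close>.
\<close>

lemma singular_perturbation_multipliers:
  fixes g :: "nat \<Rightarrow> real ^ 'n \<Rightarrow> real"
  assumes fin: "finite (I \<union> J)" and disj: "I \<inter> J = {}"
    and reg: "\<And>x. x \<in> feasible_set g (\<lambda>_. 0) J \<Longrightarrow> MFCQ g (\<lambda>_. 0) J x"
    and sing: "singular_perturbation g I J \<alpha>"
  shows "\<exists>K x u. K \<subseteq> I \<union> J \<and> K \<inter> I \<noteq> {} \<and> (\<forall>i\<in>K \<inter> I. g i x = \<alpha>) \<and> (\<forall>i\<in>K - I. g i x = 0) \<and>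
    (\<Sum>i\<in>K. u i *\<^sub>R gradient (g i) x) = 0 \<and> sum u (K \<inter> I) = 1"
proof -
  obtain x where x: "x \<in> feasible_set g (perturbation_level I \<alpha>) (I \<union> J)"
    "\<not> MFCQ g (perturbation_level I \<alpha>) (I \<union> J) x"
    using sing unfolding singular_perturbation_def by blast
  define K where "K = {i \<in> I \<union> J. g i x = perturbation_level I \<alpha> i}"
  have K: "finite K" "K \<subseteq> I \<union> J" using fin by (auto simp: K_def)
  have act: "\<forall>i\<in>K \<inter> I. g i x = \<alpha>" "\<forall>i\<in>K - I. g i x = 0"
    by (auto simp: K_def perturbation_level_def)
  have "\<nexists>y. \<forall>i\<in>K. y \<bullet> gradient (g i) x < 0"
    using x(2) unfolding MFCQ_def K_def by blast
  from gordan[OF K(1) this] obtain u where u: "\<And>i. i \<in> K \<Longrightarrow> u i \<ge> 0" "sum u K = 1"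
      "(\<Sum>i\<in>K. u i *\<^sub>R gradient (g i) x) = 0" by blast
  define s where "s = sum u (K \<inter> I)"
  have "s \<noteq> 0"
  proof
    assume "s = 0"
    then have uI: "u i = 0" if "i \<in> K \<inter> I" for i
      using that K u(1) unfolding s_def by (subst (asm) sum_nonneg_eq_0_iff) auto
    have "x \<in> feasible_set g (\<lambda>_. 0) J"
      using x(1) unfolding feasible_set_perturbation_level[OF disj] by (simp add: feasible_set_def)
    from reg[OF this] obtain y where y: "\<And>j. j \<in> J \<Longrightarrow> g j x = 0 \<Longrightarrow> y \<bullet> gradient (g j) x < 0"
      unfolding MFCQ_def by blast
    have neg: "y \<bullet> gradient (g i) x < 0" if "i \<in> K - I" for i
      using that K act(2) by (intro y) auto
    have "0 = y \<bullet> (\<Sum>i\<in>K. u i *\<^sub>R gradient (g i) x)" using u(3) by simp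
    also have "\<dots> = (\<Sum>i\<in>K. u i * (y \<bullet> gradient (g i) x))" by (simp add: inner_sum_right)
    finally have "(\<Sum>i\<in>K. - (u i * (y \<bullet> gradient (g i) x))) = 0" by (simp add: sum_negf)
    moreover have nn: "- (u i * (y \<bullet> gradient (g i) x)) \<ge> 0" if "i \<in> K" for i
      using that u(1)[OF that] neg[of i] uI[of i] by (cases "i \<in> I") (auto simp: mult_nonneg_nonpos)
    ultimately have z: "\<forall>i\<in>K. - (u i * (y \<bullet> gradient (g i) x)) = 0"
      using K(1) by (subst (asm) sum_nonneg_eq_0_iff) auto
    have "u i = 0" if "i \<in> K" for i
      using that z neg[of i] uI[of i] by (cases "i \<in> I") fastforce+
    then show False using u(2) by simp
  qed
  define w where "w i = u i / s" for i
  have "(\<Sum>i\<in>K. w i *\<^sub>R gradient (g i) x) = inverse s *\<^sub>R (\<Sum>i\<in>K. u i *\<^sub>R gradient (g i) x)"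
    unfolding scaleR_sum_right by (simp add: w_def divide_inverse mult.commute)
  moreover have "sum w (K \<inter> I) = 1"
    using \<open>s \<noteq> 0\<close> unfolding w_def sum_divide_distrib[symmetric] s_def[symmetric] by simp
  moreover have "K \<inter> I \<noteq> {}" using \<open>s \<noteq> 0\<close> s_def by auto
  ultimately show ?thesis using K act u(3)
    by (intro exI[of _ K] exI[of _ x] exI[of _ w]) auto
qed

text \<open>
  At the point formed by \<open>x\<close> and the multipliers, the derivatives of the Lagrange function in the
  multipliers vanish because all constraints of \<open>K\<close> are active; those in \<open>x\<close> vanish because the
  normalization makes the coefficient of the gradient of \<open>g k\<close> equal to \<open>u k\<close>.
\<close>

lemma multipliers_critical_value:
  fixes g :: "nat \<Rightarrow> real ^ 'n \<Rightarrow> real"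
  assumes K: "finite K" "k \<in> K \<inter> I"
    and act: "\<forall>i\<in>K \<inter> I. g i x = \<alpha>" "\<forall>i\<in>K - I. g i x = 0"
    and u: "(\<Sum>i\<in>K. u i *\<^sub>R gradient (g i) x) = 0" "sum u (K \<inter> I) = 1"
  shows "\<exists>z. \<alpha> = lagrangian g I K k z \<and>
    (\<forall>v\<in>range Inl \<union> Inr ` (K - {k}). lagrangian_partial g I K k v z = 0)"
proof -
  define z where "z = (\<lambda>v. case v of Inl j \<Rightarrow> x $ j | Inr i \<Rightarrow> u i)"
  have px: "point_of z = x" by (simp add: point_of_def z_def)
  have zu: "z (Inr i) = u i" for i by (simp add: z_def)
  have level: "g i x - of_bool (i \<in> I) * g k x = 0" if "i \<in> K" for i
    using that K act by auto
  have "lagrangian_partial g I K k (Inl j) z = 0" for j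
  proof -
    let ?G = "\<lambda>i. gradient (g i) x $ j"
    have "(\<Sum>i\<in>K. u i * ?G i) = (\<Sum>i\<in>K. u i *\<^sub>R gradient (g i) x) $ j" by simp
    then have "(\<Sum>i\<in>K - {k}. u i * ?G i) = - (u k * ?G k)"
      using K u(1) by (simp add: sum.remove[of K k])
    moreover have "(\<Sum>i\<in>K - {k}. u i * of_bool (i \<in> I)) = 1 - u k"
    proof -
      have "K \<inter> I - {k} = (K - {k}) \<inter> I" by blast
      then show ?thesis using K sum.remove[of "K \<inter> I" k u] u(2) by simp
    qed
    moreover have "lagrangian_partial g I K k (Inl j) z =
        ?G k + ((\<Sum>i\<in>K - {k}. u i * ?G i) - (\<Sum>i\<in>K - {k}. u i * of_bool (i \<in> I)) * ?G k)"
      by (simp add: lagrangian_partial_def px zu right_diff_distrib sum_subtractf sum_distrib_right mult.assoc)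
    ultimately have "lagrangian_partial g I K k (Inl j) z = ?G k + (- (u k * ?G k) - (1 - u k) * ?G k)"
      by (simp only:)
    then show ?thesis by (simp add: left_diff_distrib)
  qed
  moreover have "lagrangian_partial g I K k (Inr i) z = 0" if "i \<in> K - {k}" for i
    using level[of i] that by (simp add: lagrangian_partial_def px)
  moreover have "lagrangian g I K k z = \<alpha>"
  proof -
    have "(\<Sum>i\<in>K - {k}. z (Inr i) * (g i x - of_bool (i \<in> I) * g k x)) = 0"
      by (rule sum.neutral, rule ballI, subst level) auto
    then show ?thesis using K(2) act(1) by (simp add: lagrangian_def px)
  qed
  ultimately show ?thesis by (intro exI[of _ z]) auto
qed

section \<open>The number of singular perturbations\<close>

theorem theorem3p10:
  fixes d m :: nat
    and g :: "nat \<Rightarrow> real ^ 'n \<Rightarrow> real"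
    and I J :: "nat set"
  assumes "d \<ge> 1"
    and "\<And>i. i \<in> {1..m} \<Longrightarrow> poly_function_deg_le d (g i)"
    and "I \<union> J = {1..m}"
    and "I \<inter> J = {}"
    and "\<And>x. x \<in> feasible_set g (\<lambda>_. 0) J \<Longrightarrow> MFCQ g (\<lambda>_. 0) J x"
  shows "finite {\<alpha>. singular_perturbation g I J \<alpha>} \<and>
         card {\<alpha>. singular_perturbation g I J \<alpha>}
           \<le> d * (2 * d - 1) ^ CARD('n) * (2 * d + 1) ^ m"
proof -
  define k where "k K = Min (K \<inter> I)" for K
  define CV where "CV K = {lagrangian g I K (k K) z | z.
      \<forall>v\<in>range Inl \<union> Inr ` (K - {k K}). lagrangian_partial g I K (k K) v z = 0}" for K
  define \<K> where "\<K> = {K. K \<subseteq> {1..m} \<and> K \<inter> I \<noteq> {}}"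
  have kK: "finite K" "k K \<in> K \<inter> I" if "K \<in> \<K>" for K
  proof -
    show "finite K" using that finite_subset by (auto simp: \<K>_def)
    then show "k K \<in> K \<inter> I" unfolding k_def using that by (intro Min_in) (auto simp: \<K>_def)
  qed
  have sub: "{\<alpha>. singular_perturbation g I J \<alpha>} \<subseteq> (\<Union>K\<in>\<K>. CV K)"
  proof safe
    fix \<alpha> assume "singular_perturbation g I J \<alpha>"
    from singular_perturbation_multipliers[OF _ assms(4,5) this] obtain K x u where
      K: "K \<in> \<K>" and *: "\<forall>i\<in>K \<inter> I. g i x = \<alpha>" "\<forall>i\<in>K - I. g i x = 0"
        "(\<Sum>i\<in>K. u i *\<^sub>R gradient (g i) x) = 0" "sum u (K \<inter> I) = 1"
      unfolding \<K>_def assms(3) by auto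
    from multipliers_critical_value[OF kK[OF K] *] have "\<alpha> \<in> CV K" unfolding CV_def by blast
    with K show "\<alpha> \<in> (\<Union>K\<in>\<K>. CV K)" by blast
  qed
  have CV: "finite (CV K) \<and> card (CV K) \<le> (2 * d - 1) ^ (CARD('n) + card K)" if "K \<in> \<K>" for K
    unfolding CV_def using that kK[OF that]
    by (intro lagrangian_critical_values assms(1,2)) (auto simp: \<K>_def)
  have \<K>: "finite \<K>" "\<K> \<subseteq> Pow {1..m}" by (auto simp: \<K>_def)
  have fin: "finite (\<Union>K\<in>\<K>. CV K)" using \<K>(1) CV by blast
  have "card {\<alpha>. singular_perturbation g I J \<alpha>} \<le> card (\<Union>K\<in>\<K>. CV K)"
    by (rule card_mono[OF fin sub])
  also have "\<dots> \<le> (\<Sum>K\<in>\<K>. card (CV K))" by (rule card_UN_le[OF \<K>(1)])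
  also have "\<dots> \<le> (\<Sum>K\<in>\<K>. (2 * d - 1) ^ (CARD('n) + card K))"
    using CV by (intro sum_mono) blast
  also have "\<dots> \<le> (\<Sum>K\<in>Pow {1..m}. (2 * d - 1) ^ (CARD('n) + card K))"
    by (rule sum_mono2[OF _ \<K>(2)]) auto
  also have "\<dots> = (2 * d - 1) ^ CARD('n) * (2 * d - 1 + 1) ^ card {1..m}"
    unfolding power_add sum_distrib_left[symmetric] by (simp only: sum_power_card_Pow finite_atLeastAtMost)
  also have "\<dots> \<le> (2 * d - 1) ^ CARD('n) * (2 * d + 1) ^ m"
    by (intro mult_le_mono2) (simp add: power_mono)
  also have "\<dots> \<le> d * ((2 * d - 1) ^ CARD('n) * (2 * d + 1) ^ m)" using assms(1) by simp
  finally show ?thesis using finite_subset[OF sub fin] by (simp add: mult.assoc)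
qed

end
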